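(* Let $E$ be an elliptic curve over $\mathbb{Q}$ given by a Weierstrass equation $y^2+a_1xy+a_3y=x^3+a_2x^2+a_4x+a_6$ with $a_1,a_2,a_3,a_4,a_6\in\mathbb{Z}$, and let $P\in E(\mathbb{Q})$ be a non-torsion point. Let $\{\beta_n\}_{n\in\mathbb{N}}=\{\beta_n(E,P)\}_{n\in\mathbb{N}}$ be the sequence defined in the context. Let $n\geq m\geq r$ be positive integers such that at least two of $n,m,r$ are multiples of $M(P)$. Then \[ \beta_{n+m}\beta_{n-m}\beta_r^2=\beta_{m+r}\beta_{m-r}\beta_n^2-\beta_{n+r}\beta_{n-r}\beta_m^2 . \]
   Context: Put $b_2=a_1^2+4a_2$, $b_4=2a_4+a_1a_3$, $b_6=a_3^2+4a_6$, $b_8=a_1^2a_6+4a_2a_6-a_1a_3a_4+a_2a_3^2-a_4^2$. The division polynomials $\psi_n\in\mathbb{Z}[a_1,\dots,a_6,x,y]$ are defined by $\psi_0=0$, $\psi_1=1$, $\psi_2=2y+a_1x+a_3$, $\psi_3=3x^4+b_2x^3+3b_4x^2+3b_6x+b_8$, $\psi_4=\psi_2\,(2x^6+b_2x^5+5b_4x^4+10b_6x^3+10b_8x^2+(b_2b_8-b_4b_6)x+(b_4b_8-b_6^2))$, $\psi_{2n+1}=\psi_{n+2}\psi_n^3-\psi_{n-1}\psi_{n+1}^3$ for $n\geq2$, and $\psi_{2n}\psi_2=\psi_n\psi_{n+2}\psi_{n-1}^2-\psi_n\psi_{n-2}\psi_{n+1}^2$ for $n\geq3$. For $n\in\mathbb{N}$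 write $x(nP)=A_n/B_n^2$ with $A_n,B_n$ coprime integers and $B_n\geq0$; if $nP=O$ put $B_n=0$. Define $\beta_n(E,P)=\operatorname{sign}(\psi_n(x(P),y(P)))\cdot B_n/B_1$ (an integer). For a prime $p$, let $E_0(\mathbb{Q}_p)$ be the subgroup of points of $E(\mathbb{Q}_p)$ whose reduction modulo $p$ (with respect to the given integral Weierstrass equation) is a non-singular point of the reduced curve, and let $r(p,P)$ be the order of $P$ in the finite group $E(\mathbb{Q}_p)/E_0(\mathbb{Q}_p)$. Define $M(P)=\operatorname{lcm}_p\, r(p,P)$ (a well-defined positive integer since $r(p,P)=1$ for all but finitely many $p$).
   Formalization: The two terms on the right are interchanged: the relation proved is β_{n+m}β_{n−m}β_r² = β_{n+r}β_{n−r}β_m² − β_{m+r}β_{m−r}β_n². As printed the sign is wrong: m = r = M(P), n = 2M(P) would make a non-zero number equal its negative. *)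

theory Defs
  imports
    Complex_Main
    "HOL-Algebra.Algebraic_Closure_Type"
    "HOL-Algebra.QuotRing"
    "HOL-Number_Theory.Residues"
begin

subsection \<open>Weierstrass equations with integral coefficients\<close>

datatype weierstrass =
  Weierstrass (a\<^sub>1: int) (a\<^sub>2: int) (a\<^sub>3: int) (a\<^sub>4: int) (a\<^sub>6: int)

definition b\<^sub>2 :: "weierstrass \<Rightarrow> int" where
  "b\<^sub>2 E = (a\<^sub>1 E)\<^sup>2 + 4 * a\<^sub>2 E"

definition b\<^sub>4 :: "weierstrass \<Rightarrow> int" where
  "b\<^sub>4 E = 2 * a\<^sub>4 E + a\<^sub>1 E * a\<^sub>3 E"

definition b\<^sub>6 :: "weierstrass \<Rightarrow> int" where
  "b\<^sub>6 E = (a\<^sub>3 E)\<^sup>2 + 4 * a\<^sub>6 E"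

definition b\<^sub>8 :: "weierstrass \<Rightarrow> int" where
  "b\<^sub>8 E = (a\<^sub>1 E)\<^sup>2 * a\<^sub>6 E + 4 * a\<^sub>2 E * a\<^sub>6 E - a\<^sub>1 E * a\<^sub>3 E * a\<^sub>4 E
          + a\<^sub>2 E * (a\<^sub>3 E)\<^sup>2 - (a\<^sub>4 E)\<^sup>2"

definition discriminant :: "weierstrass \<Rightarrow> int" where
  "discriminant E = - (b\<^sub>2 E)\<^sup>2 * b\<^sub>8 E - 8 * b\<^sub>4 E ^ 3 - 27 * (b\<^sub>6 E)\<^sup>2
                    + 9 * b\<^sub>2 E * b\<^sub>4 E * b\<^sub>6 E"

definition elliptic_curve :: "weierstrass \<Rightarrow> bool" where
  "elliptic_curve E \<longleftrightarrow> discriminant E \<noteq> 0"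


subsection \<open>Points over a field, and the group law\<close>

text \<open>
  The field is a ring record \<open>R\<close>, since the fields \<open>\<rat>\<^sub>p\<close> for varying \<open>p\<close> must occur in a
  single formula. An integer \<open>k\<close> is read in \<open>R\<close> as \<open>[k] \<cdot> \<one>\<close>.
\<close>

datatype 'a point = Infinity | Affine 'a 'a

context
  fixes R :: "('a, 'm) ring_scheme" (structure)
begin

abbreviation const_in :: "int \<Rightarrow> 'a" where
  "const_in k \<equiv> [k] \<cdot> \<one>"

definition on_curve :: "weierstrass \<Rightarrow> 'a \<Rightarrow> 'a \<Rightarrow> bool" where
  "on_curve E x y \<longleftrightarrow>
     y [^] (2::nat) \<oplus> const_in (a\<^sub>1 E) \<otimes> x \<otimes> y \<oplus> const_in (a\<^sub>3 E) \<otimes> y =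
     x [^] (3::nat) \<oplus> const_in (a\<^sub>2 E) \<otimes> x [^] (2::nat) \<oplus> const_in (a\<^sub>4 E) \<otimes> x
       \<oplus> const_in (a\<^sub>6 E)"

text \<open>
  The two partial derivatives of
  \<open>y\<^sup>2 + a\<^sub>1 x y + a\<^sub>3 y - (x\<^sup>3 + a\<^sub>2 x\<^sup>2 + a\<^sub>4 x + a\<^sub>6)\<close>.
\<close>

definition curve_dx :: "weierstrass \<Rightarrow> 'a \<Rightarrow> 'a \<Rightarrow> 'a" where
  "curve_dx E x y =
     const_in (a\<^sub>1 E) \<otimes> y
       \<ominus> (const_in 3 \<otimes> x [^] (2::nat) \<oplus> const_in (2 * a\<^sub>2 E) \<otimes> x \<oplus> const_in (a\<^sub>4 E))"

definition curve_dy :: "weierstrass \<Rightarrow> 'a \<Rightarrow> 'a \<Rightarrow> 'a" where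
  "curve_dy E x y = const_in 2 \<otimes> y \<oplus> const_in (a\<^sub>1 E) \<otimes> x \<oplus> const_in (a\<^sub>3 E)"

text \<open>The point at infinity of a Weierstrass cubic is never singular.\<close>

fun nonsingular_point :: "weierstrass \<Rightarrow> 'a point \<Rightarrow> bool" where
  "nonsingular_point E Infinity \<longleftrightarrow> True"
| "nonsingular_point E (Affine x y) \<longleftrightarrow>
     on_curve E x y \<and> \<not> (curve_dx E x y = \<zero> \<and> curve_dy E x y = \<zero>)"

text \<open>
  Chord-and-tangent law. The tangent at \<open>(x, y)\<close> has slope \<open>- curve_dx / curve_dy\<close>, and
  \<open>(x, y)\<close>, \<open>(x, y')\<close> are opposite iff \<open>y + y' + a\<^sub>1 x + a\<^sub>3 = 0\<close>.
\<close>

definition slope ::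
    "weierstrass \<Rightarrow> 'a \<Rightarrow> 'a \<Rightarrow> 'a \<Rightarrow> 'a \<Rightarrow> 'a" where
  "slope E x\<^sub>1 y\<^sub>1 x\<^sub>2 y\<^sub>2 =
     (if x\<^sub>1 = x\<^sub>2 then (\<ominus> curve_dx E x\<^sub>1 y\<^sub>1) \<otimes> inv (curve_dy E x\<^sub>1 y\<^sub>1)
      else (y\<^sub>2 \<ominus> y\<^sub>1) \<otimes> inv (x\<^sub>2 \<ominus> x\<^sub>1))"

fun point_add ::
    "weierstrass \<Rightarrow> 'a point \<Rightarrow> 'a point \<Rightarrow> 'a point" where
  "point_add E Infinity Q = Q"
| "point_add E (Affine x\<^sub>1 y\<^sub>1) Infinity = Affine x\<^sub>1 y\<^sub>1"
| "point_add E (Affine x\<^sub>1 y\<^sub>1) (Affine x\<^sub>2 y\<^sub>2) =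
     (if x\<^sub>1 = x\<^sub>2 \<and> y\<^sub>1 \<oplus> y\<^sub>2 \<oplus> const_in (a\<^sub>1 E) \<otimes> x\<^sub>1 \<oplus> const_in (a\<^sub>3 E) = \<zero>
      then Infinity
      else let l = slope E x\<^sub>1 y\<^sub>1 x\<^sub>2 y\<^sub>2;
               x\<^sub>3 = l [^] (2::nat) \<oplus> const_in (a\<^sub>1 E) \<otimes> l \<ominus> const_in (a\<^sub>2 E) \<ominus> x\<^sub>1 \<ominus> x\<^sub>2;
               y\<^sub>3 = l \<otimes> (x\<^sub>1 \<ominus> x\<^sub>3) \<ominus> y\<^sub>1 \<ominus> const_in (a\<^sub>1 E) \<otimes> x\<^sub>3 \<ominus> const_in (a\<^sub>3 E)
           in Affine x\<^sub>3 y\<^sub>3)"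

definition curve_group :: "weierstrass \<Rightarrow> 'a point monoid" where
  "curve_group E =
     \<lparr>carrier = insert Infinity
        {Affine x y |x y. x \<in> carrier R \<and> y \<in> carrier R \<and> on_curve E x y},
      monoid.mult = point_add E, one = Infinity\<rparr>"

end

abbreviation EQ :: "weierstrass \<Rightarrow> rat point monoid" where
  "EQ E \<equiv> curve_group ring_of_type_algebra E"

definition non_torsion :: "weierstrass \<Rightarrow> rat point \<Rightarrow> bool" where
  "non_torsion E P \<longleftrightarrow> (\<forall>k::nat. k > 0 \<longrightarrow> P [^]\<^bsub>EQ E\<^esub> k \<noteq> \<one>\<^bsub>EQ E\<^esub>)"


subsection \<open>Division polynomials\<close>

text \<open>
  An element of \<open>\<int>[x][y]\<close> is an \<open>int poly poly\<close> whose outer variable is \<open>y\<close>. The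
  coefficients \<open>a\<^sub>i\<close> are specialised to those of \<open>E\<close>; as \<open>2 y + a\<^sub>1 x + a\<^sub>3\<close> stays non-zero, the
  (exact) division by \<open>\<psi>\<^sub>2\<close> is compatible with that.
\<close>

definition psi2 :: "weierstrass \<Rightarrow> int poly poly" where
  "psi2 E = [:[:a\<^sub>3 E, a\<^sub>1 E:], 2:]"

function psi :: "weierstrass \<Rightarrow> nat \<Rightarrow> int poly poly" where
  "psi E n =
    (if n = 0 then 0
     else if n = 1 then 1
     else if n = 2 then psi2 E
     else if n = 3 then [:[:b\<^sub>8 E, 3 * b\<^sub>6 E, 3 * b\<^sub>4 E, b\<^sub>2 E, 3:]:]
     else if n = 4 then
       psi2 E * [:[:b\<^sub>4 E * b\<^sub>8 E - (b\<^sub>6 E)\<^sup>2, b\<^sub>2 E * b\<^sub>8 E - b\<^sub>4 E * b\<^sub>6 E, 10 * b\<^sub>8 E,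
                    10 * b\<^sub>6 E, 5 * b\<^sub>4 E, b\<^sub>2 E, 2:]:]
     else let k = n div 2 in
       if odd n then psi E (k + 2) * psi E k ^ 3 - psi E (k - 1) * psi E (k + 1) ^ 3
       else (psi E k * psi E (k + 2) * (psi E (k - 1))\<^sup>2
             - psi E k * psi E (k - 2) * (psi E (k + 1))\<^sup>2) div psi2 E)"
  by auto
termination
proof -
  have *: "n div 2 + 2 < n" if "n \<noteq> 0" "n \<noteq> 1" "n \<noteq> 2" "n \<noteq> 3" "n \<noteq> 4" for n :: nat
    using that by presburger
  show ?thesis
    by (relation "measure snd"; use * in \<open>force simp del: One_nat_def\<close>)
qed

declare psi.simps [simp del]

definition eval2 :: "int poly poly \<Rightarrow> rat \<Rightarrow> rat \<Rightarrow> rat" where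
  "eval2 f x y = poly (map_poly (\<lambda>c. poly (map_poly of_int c) x) f) y"


subsection \<open>The sequence \<open>\<beta>\<close>\<close>

fun denom_root :: "rat point \<Rightarrow> int" where
  "denom_root Infinity = 0"
| "denom_root (Affine x y) =
     (THE B. B > 0 \<and> (\<exists>A. coprime A B \<and> x = of_int A / (of_int B)\<^sup>2))"

definition B_seq :: "weierstrass \<Rightarrow> rat point \<Rightarrow> nat \<Rightarrow> int" where
  "B_seq E P n = denom_root (P [^]\<^bsub>EQ E\<^esub> n)"

fun psi_at :: "weierstrass \<Rightarrow> nat \<Rightarrow> rat point \<Rightarrow> rat" where
  "psi_at E n (Affine x y) = eval2 (psi E n) x y"
| "psi_at E n Infinity = undefined"

text \<open>
  Pitfall: since \<open>\<psi>\<^sub>5 = \<psi>\<^sub>4 \<psi>\<^sub>2\<^sup>3 - \<psi>\<^sub>1 \<psi>\<^sub>3\<^sup>3\<close>, for \<open>n \<ge> m \<ge> r\<close> the elliptic relation reads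
  \<open>\<beta>\<^bsub>n+m\<^esub> \<beta>\<^bsub>n-m\<^esub> \<beta>\<^sub>r\<^sup>2 = \<beta>\<^bsub>n+r\<^esub> \<beta>\<^bsub>n-r\<^esub> \<beta>\<^sub>m\<^sup>2 - \<beta>\<^bsub>m+r\<^esub> \<beta>\<^bsub>m-r\<^esub> \<beta>\<^sub>n\<^sup>2\<close>. With the two terms on
  the right interchanged (a misprint found in print, correct for \<open>\<beta>\<^bsub>m-n\<^esub>\<close> and \<open>m \<ge> n \<ge> r\<close>) it fails
  for every non-torsion point: \<open>m = r < n\<close> would give
  \<open>\<beta>\<^bsub>n+m\<^esub> \<beta>\<^bsub>n-m\<^esub> \<beta>\<^sub>m\<^sup>2 = - \<beta>\<^bsub>n+m\<^esub> \<beta>\<^bsub>n-m\<^esub> \<beta>\<^sub>m\<^sup>2\<close>, a non-zero number equal to its negative.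
\<close>

definition beta :: "weierstrass \<Rightarrow> rat point \<Rightarrow> nat \<Rightarrow> rat" where
  "beta E P n = sgn (psi_at E n P) * of_int (B_seq E P n) / of_int (B_seq E P 1)"


subsection \<open>The field \<open>\<rat>\<^sub>p\<close> as completion of \<open>\<rat>\<close>\<close>

definition padic_abs :: "nat \<Rightarrow> rat \<Rightarrow> real" where
  "padic_abs p x =
     (if x = 0 then 0
      else let (a, b) = quotient_of x
           in real p powi (int (multiplicity (int p) b) - int (multiplicity (int p) a)))"

definition padic_cauchy_ring :: "nat \<Rightarrow> (nat \<Rightarrow> rat) ring" where
  "padic_cauchy_ring p =
     \<lparr>carrier = {s. \<forall>e>0. \<exists>N. \<forall>i\<ge>N. \<forall>j\<ge>N. padic_abs p (s i - s j) < e},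
      monoid.mult = (\<lambda>s t i. s i * t i), one = (\<lambda>_. 1),
      ring.zero = (\<lambda>_. 0), add = (\<lambda>s t i. s i + t i)\<rparr>"

definition padic_null :: "nat \<Rightarrow> (nat \<Rightarrow> rat) set" where
  "padic_null p = {s. (\<lambda>i. padic_abs p (s i)) \<longlonglongrightarrow> 0}"

definition Qp :: "nat \<Rightarrow> (nat \<Rightarrow> rat) set ring" where
  "Qp p = padic_cauchy_ring p Quot padic_null p"

definition of_rat_Qp :: "nat \<Rightarrow> rat \<Rightarrow> (nat \<Rightarrow> rat) set" where
  "of_rat_Qp p x = padic_null p +>\<^bsub>padic_cauchy_ring p\<^esub> (\<lambda>_. x)"

definition Qp_abs :: "nat \<Rightarrow> (nat \<Rightarrow> rat) set \<Rightarrow> real" where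
  "Qp_abs p u = lim (\<lambda>i. padic_abs p ((SOME s. s \<in> u) i))"

definition Zp :: "nat \<Rightarrow> (nat \<Rightarrow> rat) set set" where
  "Zp p = {u \<in> carrier (Qp p). Qp_abs p u \<le> 1}"

text \<open>
  Residue class of a \<open>p\<close>-adic integer, as an element of \<^const>\<open>residue_ring\<close>, whose carrier is
  \<open>{0..p - 1}\<close>.
\<close>

definition residue_Zp :: "nat \<Rightarrow> (nat \<Rightarrow> rat) set \<Rightarrow> int" where
  "residue_Zp p u =
     (THE a. a \<in> carrier (residue_ring (int p)) \<and>
             Qp_abs p (u \<ominus>\<^bsub>Qp p\<^esub> of_rat_Qp p (of_int a)) < 1)"


subsection \<open>Reduction modulo \<open>p\<close>\<close>

text \<open>
  On an integral Weierstrass equation a point with a non-integral coordinate has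
  homogeneous coordinates reducing to \<open>[0 : 1 : 0]\<close>.
\<close>

fun reduce_point :: "nat \<Rightarrow> (nat \<Rightarrow> rat) set point \<Rightarrow> int point" where
  "reduce_point p Infinity = Infinity"
| "reduce_point p (Affine x y) =
     (if x \<in> Zp p \<and> y \<in> Zp p then Affine (residue_Zp p x) (residue_Zp p y) else Infinity)"

abbreviation EQp :: "weierstrass \<Rightarrow> nat \<Rightarrow> (nat \<Rightarrow> rat) set point monoid" where
  "EQp E p \<equiv> curve_group (Qp p) E"

definition E0 :: "weierstrass \<Rightarrow> nat \<Rightarrow> (nat \<Rightarrow> rat) set point set" where
  "E0 E p = {Q \<in> carrier (EQp E p). nonsingular_point (residue_ring (int p)) E (reduce_point p Q)}"

text \<open>
  The order of the class of \<open>P\<close> in \<open>E(\<rat>\<^sub>p) / E\<^sub>0(\<rat>\<^sub>p)\<close>: the least \<open>k > 0\<close> such that \<open>k\<close> times this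
  class is trivial, that is \<open>k P \<in> E\<^sub>0(\<rat>\<^sub>p)\<close>. An infinite order would be \<open>0\<close>, as for
  \<open>group.ord\<close>; this does not occur, the quotient being finite.
\<close>

definition order_mod_E0 :: "weierstrass \<Rightarrow> rat point \<Rightarrow> nat \<Rightarrow> nat" where
  "order_mod_E0 E P p =
     (let trivial = (\<lambda>k::nat. k > 0 \<and> map_point (of_rat_Qp p) P [^]\<^bsub>EQp E p\<^esub> k \<in> E0 E p)
      in if \<exists>k. trivial k then (LEAST k. trivial k) else 0)"

definition M_of :: "weierstrass \<Rightarrow> rat point \<Rightarrow> nat" where
  "M_of E P = (LCM p\<in>{p. Factorial_Ring.prime p}. order_mod_E0 E P p)"

end

theory Submission
  imports Defs
begin

text \<open>
  Write \<open>x\<^sub>n = x(nP)\<close> and \<open>W\<^sub>n = \<psi>\<^sub>n(P)\<close>. Ward's identity says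
  \<open>W\<^bsub>n+m\<^esub> W\<^bsub>n-m\<^esub> = W\<^sub>n\<^sup>2 W\<^sub>m\<^sup>2 (x\<^sub>m - x\<^sub>n)\<close>. If, for every prime, at least one of \<open>nP\<close>, \<open>mP\<close> has
  non-singular reduction, then no cancellation occurs and also
  \<open>B\<^bsub>n+m\<^esub> B\<^bsub>n-m\<^esub> = B\<^sub>n\<^sup>2 B\<^sub>m\<^sup>2 \<bar>x\<^sub>m - x\<^sub>n\<bar>\<close>; hence
  \<open>\<beta>\<^bsub>n+m\<^esub> \<beta>\<^bsub>n-m\<^esub> = B\<^sub>1\<^sup>2 (x\<^sub>m - x\<^sub>n) \<beta>\<^sub>n\<^sup>2 \<beta>\<^sub>m\<^sup>2\<close>. When two of \<open>n, m, r\<close> are multiples of \<open>M(P)\<close> this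
  applies to all three pairs, and the theorem becomes
  \<open>x\<^sub>m - x\<^sub>n = (x\<^sub>r - x\<^sub>n) - (x\<^sub>r - x\<^sub>m)\<close>.

  Associativity of the group law is not needed. Everything is read off the polynomial
  \<open>G(u, v, t)\<close>, symmetric in its three arguments, with
  \<open>G(x(Q), x(R), t) = (x(Q) - x(R))\<^sup>2 (x(Q+R) - t) (x(Q-R) - t)\<close>. For \<open>R = P\<close> this is the
  chord law; the symmetry of \<open>G\<close> turns it into Ward's identity, which in turn gives the case
  \<open>Q = nP\<close>, \<open>R = mP\<close>. The coefficients of \<open>G(x(Q), x(R), t)\<close>, as integral forms in the
  numerators and denominators, have a common prime divisor \<open>p\<close> only if \<open>Q\<close> and \<open>R\<close> are both
  singular modulo \<open>p\<close>, so Gauss' lemma computes the denominators of \<open>x(Q\<plusminus>R)\<close>.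
\<close>

subsection \<open>Elliptic sequences from the chord law\<close>

text \<open>
  \<open>(u - v)\<^sup>2 t\<^sup>2 - (u - v)\<^sup>2 (x(Q+R) + x(Q-R)) t + (u - v)\<^sup>2 x(Q+R) x(Q-R)\<close> for \<open>u = x(Q)\<close>,
  \<open>v = x(R)\<close>, expressed by \<open>u\<close>, \<open>v\<close> and the \<open>b\<^sub>i\<close>.
\<close>

definition quad_form :: "'a::idom \<Rightarrow> 'a \<Rightarrow> 'a \<Rightarrow> 'a \<Rightarrow> 'a \<Rightarrow> 'a \<Rightarrow> 'a \<Rightarrow> 'a" where
  "quad_form b2 b4 b6 b8 u v t =
     (u - v)\<^sup>2 * t\<^sup>2 - ((u + v) * (b4 + 2 * u * v) + b2 * u * v + b6) * t
     + (u\<^sup>2 * v\<^sup>2 - b4 * u * v - b6 * (u + v) - b8)"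

lemma quad_form_swap: "quad_form b2 b4 b6 b8 u v t = quad_form b2 b4 b6 b8 v u t"
  unfolding quad_form_def by Groebner_Basis.algebra

text \<open>Swap and rotation generate all permutations of u, v, t. Conceptually, on an elliptic
  curve the form vanishes at the x-coordinates of affine points Q, R, S exactly when Q \<plusminus>
  R \<plusminus> S = O for some choice of signs.\<close>

lemma quad_form_rotate: "quad_form b2 b4 b6 b8 u v t = quad_form b2 b4 b6 b8 v t u"
  unfolding quad_form_def by Groebner_Basis.algebra

text \<open>The relation W_{n+1} W_{n-1} = (x_1 - x_n) W_n^2, solved for the next term. At n = 1 it
  reads 0 = 0 and leaves W_2 free, hence the parameter h. \<open>psi_eq_W\<close> identifies the
  terms with the values psi_n(P).\<close>

fun ward_seq :: "'a::field \<Rightarrow> (nat \<Rightarrow> 'a) \<Rightarrow> nat \<Rightarrow> 'a" where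
  "ward_seq h x 0 = 0"
| "ward_seq h x (Suc 0) = 1"
| "ward_seq h x (Suc (Suc 0)) = h"
| "ward_seq h x (Suc (Suc (Suc n))) =
     (x 1 - x (Suc (Suc n))) * (ward_seq h x (Suc (Suc n)))\<^sup>2 / ward_seq h x (Suc n)"

text \<open>Intended: \<open>x n = x(nP)\<close> and \<open>h n = 2 y(nP) + a\<^sub>1 x(nP) + a\<^sub>3\<close>.\<close>

locale x_multiples =
  fixes b2 b4 b6 b8 :: "'a::field" and x h :: "nat \<Rightarrow> 'a"
  assumes b8: "4 * b8 = b2 * b6 - b4\<^sup>2"
    and h_square: "n \<ge> 1 \<Longrightarrow> (h n)\<^sup>2 = 4 * x n ^ 3 + b2 * (x n)\<^sup>2 + 2 * b4 * x n + b6"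
    and x_two: "(h 1)\<^sup>2 * x 2 = x 1 ^ 4 - b4 * (x 1)\<^sup>2 - 2 * b6 * x 1 - b8"
    and x_sum: "n \<ge> 2 \<Longrightarrow> (x (n + 1) + x (n - 1)) * (x n - x 1)\<^sup>2 =
       (x n + x 1) * (b4 + 2 * x n * x 1) + b2 * x n * x 1 + b6"
    and x_prod: "n \<ge> 2 \<Longrightarrow> x (n + 1) * x (n - 1) * (x n - x 1)\<^sup>2 =
       (x n)\<^sup>2 * (x 1)\<^sup>2 - b4 * x n * x 1 - b6 * (x n + x 1) - b8"
    and x_diff: "n \<ge> 2 \<Longrightarrow> (x (n - 1) - x (n + 1)) * (x n - x 1)\<^sup>2 = h n * h 1"
    and x_neq: "n \<ge> 2 \<Longrightarrow> x n \<noteq> x 1"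
    and h_one_nonzero: "h 1 \<noteq> 0"
begin

abbreviation G where "G \<equiv> quad_form b2 b4 b6 b8"
abbreviation W where "W \<equiv> ward_seq (h 1) x"

lemma W_nonzero: "n \<ge> 1 \<Longrightarrow> W n \<noteq> 0"
proof (induction n rule: less_induct)
  case (less n)
  consider "n = 1" | "n = 2" | k where "n = Suc (Suc (Suc k))"
    using less.prems by (metis One_nat_def Suc_1 not0_implies_Suc not_one_le_zero)
  then show ?case
  proof cases
    case (3 k)
    then show ?thesis using less.IH[of "Suc k"] less.IH[of "Suc (Suc k)"] x_neq[of "Suc (Suc k)"] by auto
  qed (use h_one_nonzero in \<open>auto simp: numeral_2_eq_2\<close>)
qed

lemma W_step:
  assumes "n \<ge> 1"
  shows "W (n + 1) * W (n - 1) = (x 1 - x n) * (W n)\<^sup>2"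
proof (cases "n = 1")
  case False
  then obtain k where "n = Suc (Suc k)" using assms by (metis One_nat_def Suc_le_D le_antisym not_less_eq_eq)
  then show ?thesis using W_nonzero[of "Suc k"] by simp
qed simp

lemma G_one:
  assumes "n \<ge> 2"
  shows "G (x n) (x 1) t = (x 1 - x n)\<^sup>2 * ((x (n + 1) - t) * (x (n - 1) - t))"
  using x_sum[OF assms] x_prod[OF assms] unfolding quad_form_def by Groebner_Basis.algebra

text \<open>The tangent law: on the diagonal the coefficient of t^2 vanishes and the form is linear
  in t.\<close>

lemma G_one_one: "G (x 1) (x 1) t = (h 1)\<^sup>2 * (x 2 - t)"
  using h_square[of 1] x_two unfolding quad_form_def by simp Groebner_Basis.algebra

text \<open>
  Multiplying the identity for \<open>(n + 1, m)\<close> with the one for \<open>(n - 1, m)\<close> gives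
  \<open>W\<^sub>n\<^sup>4 W\<^sub>m\<^sup>4 G(x\<^sub>n, x\<^sub>1, x\<^sub>m)\<close>, which is symmetric in \<open>n\<close> and \<open>m\<close>; dividing by the one for
  \<open>(n, m - 1)\<close> yields \<open>(n, m + 1)\<close>.
\<close>

lemma ward_identity_aux:
  "m \<ge> 1 \<Longrightarrow> W (2 * m + k) * W k = (W (m + k))\<^sup>2 * (W m)\<^sup>2 * (x m - x (m + k))"
proof (induction m arbitrary: k rule: less_induct)
  case (less m)
  show ?case
  proof (cases "k = 0")
    case k: False
    \<comment> \<open>m = 2 stands apart: the symmetry of \<open>G\<close> then concerns (x_n, x_1,
      x_1), where the tangent law \<open>G_one_one\<close> takes the place of
      \<open>G_one\<close>.\<close>
    consider "m = 1" | "m = 2" | j where "m = j + 2" "j \<ge> 1"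
    proof -
      have "m = 1 \<or> m = 2 \<or> m = (m - 2) + 2 \<and> m - 2 \<ge> 1" using less.prems by linarith
      then show ?thesis using that by blast
    qed
    then show ?thesis
    proof cases
      case 1
      then show ?thesis using W_step[of "k + 1"] by (simp add: ac_simps)
    next
      case 2
      define n where "n = k + 2"
      have n: "n \<ge> 2" "n - 1 \<ge> 1" "n + 1 \<ge> 1" "n - 1 + 1 = n" "n - 1 - 1 = k" "n + 1 - 1 = n" "n + 1 + 1 = k + 4" "m + k = n"
        using k by (auto simp: n_def 2)
      have 1: "W (k + 4) * W n = (x 1 - x (n + 1)) * (W (n + 1))\<^sup>2"
        using W_step[OF n(3)] unfolding n(6,7) .
      have 2: "W n * W k = (x 1 - x (n - 1)) * (W (n - 1))\<^sup>2"
        using W_step[OF n(2)] unfolding n(4,5) .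
      have 3: "W (n + 1) * W (n - 1) = (x 1 - x n) * (W n)\<^sup>2"
        using W_step[of n] n(1) by simp
      have 4: "(x 1 - x n)\<^sup>2 * ((x (n + 1) - x 1) * (x (n - 1) - x 1)) = (h 1)\<^sup>2 * (x 2 - x n)"
        using G_one[OF n(1), of "x 1"] G_one_one[of "x n"] quad_form_rotate by metis
      have "(W n)\<^sup>2 * (W (k + 4) * W k) = (W (k + 4) * W n) * (W n * W k)" by Groebner_Basis.algebra
      also have "\<dots> = (W (n + 1) * W (n - 1))\<^sup>2 * ((x (n + 1) - x 1) * (x (n - 1) - x 1))"
        unfolding 1 2 by Groebner_Basis.algebra
      also have "\<dots> = (W n)\<^sup>2 * ((W n)\<^sup>2 * (h 1)\<^sup>2 * (x 2 - x n))"
        unfolding 3 using 4 by Groebner_Basis.algebra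
      finally have "W (k + 4) * W k = (W n)\<^sup>2 * (h 1)\<^sup>2 * (x 2 - x n)"
        using W_nonzero[of n] n by simp
      moreover have "2 * m + k = k + 4" "W m = h 1" using \<open>m = 2\<close> by (auto simp: numeral_2_eq_2)
      ultimately show ?thesis unfolding n(8) using \<open>m = 2\<close> by (simp add: add.commute)
    next
      case (3 j)
      define n where "n = m + k"
      have m: "m \<ge> 2" "m \<ge> 1" "m - 1 < m" "m - 1 \<ge> 1" and n: "n \<ge> 2" "n \<ge> 1" "n = j + k + 2" using 3 by (auto simp: n_def)
      have IH1: "W (2 * (m - 1) + k') * W k' = (W (m - 1 + k'))\<^sup>2 * (W (m - 1))\<^sup>2 * (x (m - 1) - x (m - 1 + k'))" for k'
        using less.IH[of "m - 1" k'] m by simp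
      have IH2: "W (2 * (m - 2) + k') * W k' = (W (m - 2 + k'))\<^sup>2 * (W (m - 2))\<^sup>2 * (x (m - 2) - x (m - 2 + k'))" for k'
        using less.IH[of "m - 2" k'] m 3 by simp
      have idx: "m - 1 = j + 1" "m - 2 = j" using 3 by auto
      \<comment> \<open>\<open>a\<close>, \<open>b\<close> and \<open>c\<close> are the identity for
        (n + 1, m - 1), (n - 1, m - 1) and (n, m - 2). The surplus factors form Q, which is
        cancelled at the end.\<close>
      have a: "W (2 * m + k) * W (k + 2) = (W (n + 1))\<^sup>2 * (W (j + 1))\<^sup>2 * (x (j + 1) - x (n + 1))"
        using IH1[of "k + 2"] 3 n unfolding idx by (simp add: algebra_simps numeral_eq_Suc)
      have b: "W (2 * j + k + 2) * W k = (W (n - 1))\<^sup>2 * (W (j + 1))\<^sup>2 * (x (j + 1) - x (n - 1))"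
        using IH1[of k] 3 n unfolding idx by (simp add: algebra_simps numeral_eq_Suc)
      have c: "W (2 * j + k + 2) * W (k + 2) = (W n)\<^sup>2 * (W j)\<^sup>2 * (x j - x n)"
        using IH2[of "k + 2"] 3 n unfolding idx by (simp add: algebra_simps numeral_eq_Suc)
      have d: "W (n + 1) * W (n - 1) = (x 1 - x n) * (W n)\<^sup>2" using W_step[OF n(2)] .
      have e: "W m * W j = (x 1 - x (j + 1)) * (W (j + 1))\<^sup>2" using W_step[of "j + 1"] 3 by (simp del: ward_seq.simps)
      have g: "(x 1 - x n)\<^sup>2 * ((x (n + 1) - x (j + 1)) * (x (n - 1) - x (j + 1)))
             = (x 1 - x (j + 1))\<^sup>2 * ((x m - x n) * (x j - x n))"
        using G_one[OF n(1), of "x (j + 1)"] G_one[of "j + 1" "x n"] 3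
          quad_form_rotate[of b2 b4 b6 b8 "x (j + 1)" "x 1" "x n"]
          quad_form_rotate[of b2 b4 b6 b8 "x 1" "x n" "x (j + 1)"]
          quad_form_swap[of b2 b4 b6 b8 "x 1" "x n" "x (j + 1)"]
        by (simp add: ac_simps)
      define Q where "Q = W (2 * j + k + 2) * W (k + 2)"
      have Q: "Q \<noteq> 0" unfolding Q_def using W_nonzero by simp
      have "Q * (W (2 * m + k) * W k) = (W (2 * m + k) * W (k + 2)) * (W (2 * j + k + 2) * W k)"
        unfolding Q_def by Groebner_Basis.algebra
      also have "\<dots> = (W (n + 1) * W (n - 1))\<^sup>2 * (W (j + 1))^4 * ((x (n + 1) - x (j + 1)) * (x (n - 1) - x (j + 1)))"
        unfolding a b by Groebner_Basis.algebra
      also have "\<dots> = (W n)^4 * ((x 1 - x (j + 1)) * (W (j + 1))\<^sup>2)\<^sup>2 * ((x m - x n) * (x j - x n))"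
        unfolding d using g by Groebner_Basis.algebra
      also have "\<dots> = ((W n)\<^sup>2 * (W j)\<^sup>2 * (x j - x n)) * ((W n)\<^sup>2 * (W m)\<^sup>2 * (x m - x n))"
        unfolding e[symmetric] by Groebner_Basis.algebra
      also have "\<dots> = Q * ((W n)\<^sup>2 * (W m)\<^sup>2 * (x m - x n))"
        unfolding Q_def c ..
      finally show ?thesis using Q by (simp add: n_def)
    qed
  qed simp
qed

lemma ward_identity:
  assumes "m \<ge> 1" "m \<le> n"
  shows "W (n + m) * W (n - m) = (W n)\<^sup>2 * (W m)\<^sup>2 * (x m - x n)"
  using ward_identity_aux[of m "n - m"] assms by (simp add: algebra_simps flip: mult_2)

text \<open>The classical psi_{2n}(P) = psi_2(nP) psi_n(P)^4: Ward's identity for (n + 1, n - 1)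
  brings in x_{n-1} - x_{n+1}, which \<open>x_diff\<close> expresses by h_n h_1.\<close>

lemma h_eq:
  assumes "n \<ge> 1"
  shows "h n * W n ^ 4 = W (2 * n)"
proof (cases "n = 1")
  case False
  then have n: "n \<ge> 2" using assms by simp
  have 1: "W (2 * n) * h 1 = (W (n + 1) * W (n - 1))\<^sup>2 * (x (n - 1) - x (n + 1))"
    using ward_identity[of "n - 1" "n + 1"] n by (simp add: algebra_simps numeral_2_eq_2)
  have "W (2 * n) * h 1 = h n * W n ^ 4 * h 1"
    unfolding 1 W_step[OF assms] using x_diff[OF n] by Groebner_Basis.algebra
  then show ?thesis using h_one_nonzero by simp
qed (simp add: numeral_2_eq_2)

text \<open>Both sides are linear in t with slope -h_n^2, by \<open>h_square\<close>, so agreement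
  at t = x_1 suffices. There the symmetry of \<open>G\<close> and Ward's identity for (n + 1, n) and
  (n, n - 1) apply.\<close>

lemma G_double:
  assumes "n \<ge> 1"
  shows "G (x n) (x n) t = (h n)\<^sup>2 * (x (2 * n) - t)"
proof (cases "n = 1")
  case True
  then show ?thesis using G_one_one by simp
next
  case False
  then have n: "n \<ge> 2" using assms by simp
  have nz: "W n \<noteq> 0" "W (n + 1) \<noteq> 0" "W (n - 1) \<noteq> 0" using W_nonzero n by auto
  have a: "W (2 * n + 1) = (W (n + 1))\<^sup>2 * (W n)\<^sup>2 * (x n - x (n + 1))"
    using ward_identity[of n "n + 1"] n by (simp add: mult_2)
  have b: "W (2 * n - 1) = (W n)\<^sup>2 * (W (n - 1))\<^sup>2 * (x (n - 1) - x n)"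
    using ward_identity[of "n - 1" n] n by (simp add: mult_2)
  have c: "W (2 * n + 1) * W (2 * n - 1) = (x 1 - x (2 * n)) * (W (2 * n))\<^sup>2"
    using W_step[of "2 * n"] n by simp
  have "G (x n) (x n) (x 1) = (x 1 - x n)\<^sup>2 * ((x (n + 1) - x n) * (x (n - 1) - x n))"
    using G_one[OF n, of "x n"] quad_form_rotate by metis
  also have "\<dots> * W n ^ 8 = (W (n + 1) * W (n - 1))\<^sup>2 * W n ^ 4 * ((x (n + 1) - x n) * (x (n - 1) - x n))"
    unfolding W_step[OF assms] by Groebner_Basis.algebra
  also have "\<dots> = - (W (2 * n + 1) * W (2 * n - 1))"
    unfolding a b by Groebner_Basis.algebra
  also have "\<dots> = (h n)\<^sup>2 * (x (2 * n) - x 1) * W n ^ 8"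
    unfolding c h_eq[OF assms, symmetric] by Groebner_Basis.algebra
  finally have "G (x n) (x n) (x 1) = (h n)\<^sup>2 * (x (2 * n) - x 1)"
    using nz by simp
  moreover have "G (x n) (x n) t = G (x n) (x n) (x 1) + (h n)\<^sup>2 * (x 1 - t)"
    unfolding quad_form_def h_square[OF assms]
    by (simp add: algebra_simps power2_eq_square power3_eq_cube)
  ultimately show ?thesis by (simp add: algebra_simps)
qed

text \<open>
  Both sides are quadratic in \<open>t\<close> with the same leading coefficient, so it suffices to compare
  them at \<open>t = x\<^sub>1\<close> and \<open>t = x\<^sub>n\<close>, where Ward's identity applies.
\<close>

lemma G_multiples:
  assumes "m \<ge> 1" "m < n"
  shows "G (x n) (x m) t = (x n - x m)\<^sup>2 * ((x (n + m) - t) * (x (n - m) - t))"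
proof -
  have n: "n \<ge> 2" "n \<ge> 1" using assms by auto
  note nz = W_nonzero[OF n(2)] W_nonzero[OF assms(1)]
  have nz': "W (n + m) \<noteq> 0" "W (n - m) \<noteq> 0" using W_nonzero assms by auto
  note nm = ward_identity[OF assms(1) less_imp_le[OF assms(2)]]
  \<comment> \<open>The recurrence at n + m and at n - m produces four terms of W; regrouped, they
    fit Ward's identity for (n + 1, m) and (n - 1, m).\<close>
  have at_one: "G (x n) (x m) (x 1) = (x n - x m)\<^sup>2 * ((x (n + m) - x 1) * (x (n - m) - x 1))"
  proof -
    have s1: "W (n + m + 1) * W (n + m - 1) = (x 1 - x (n + m)) * (W (n + m))\<^sup>2"
      using W_step[of "n + m"] assms by simp
    have s2: "W (n - m + 1) * W (n - m - 1) = (x 1 - x (n - m)) * (W (n - m))\<^sup>2"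
      using W_step[of "n - m"] assms by simp
    have e1: "W (n + m + 1) * W (n - m + 1) = (W (n + 1))\<^sup>2 * (W m)\<^sup>2 * (x m - x (n + 1))"
      using ward_identity[of m "n + 1"] assms by (simp add: algebra_simps Suc_diff_le)
    have e2: "W (n + m - 1) * W (n - m - 1) = (W (n - 1))\<^sup>2 * (W m)\<^sup>2 * (x m - x (n - 1))"
      using ward_identity[of m "n - 1"] assms by (simp add: algebra_simps)
    have "(x n - x m)\<^sup>2 * ((x (n + m) - x 1) * (x (n - m) - x 1)) * (W n ^ 4 * W m ^ 4)
       = ((x 1 - x (n + m)) * (W (n + m))\<^sup>2) * ((x 1 - x (n - m)) * (W (n - m))\<^sup>2)"
      using nm by Groebner_Basis.algebra
    also have "\<dots> = (W (n + m + 1) * W (n - m + 1)) * (W (n + m - 1) * W (n - m - 1))"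
      unfolding s1[symmetric] s2[symmetric] by Groebner_Basis.algebra
    also have "\<dots> = (W (n + 1) * W (n - 1))\<^sup>2 * W m ^ 4 * ((x (n + 1) - x m) * (x (n - 1) - x m))"
      unfolding e1 e2 by Groebner_Basis.algebra
    also have "\<dots> = G (x n) (x 1) (x m) * (W n ^ 4 * W m ^ 4)"
      unfolding W_step[OF n(2)] G_one[OF n(1)] by Groebner_Basis.algebra
    finally have "(x n - x m)\<^sup>2 * ((x (n + m) - x 1) * (x (n - m) - x 1)) = G (x n) (x 1) (x m)"
      using nz by simp
    then show ?thesis by (metis quad_form_rotate quad_form_swap)
  qed
  \<comment> \<open>Ward's identity for (n + m, n), (n, n - m) and (2n, m), together with W_{2n} =
    h_n W_n^4, reduces this value to the doubling law.\<close>
  have at_n: "G (x n) (x m) (x n) = (x n - x m)\<^sup>2 * ((x (n + m) - x n) * (x (n - m) - x n))"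
  proof -
    have e1: "W (2 * n + m) * W m = (W (n + m))\<^sup>2 * (W n)\<^sup>2 * (x n - x (n + m))"
      using ward_identity[of n "n + m"] n by (simp add: algebra_simps flip: mult_2)
    have e2: "W (2 * n - m) * W m = (W n)\<^sup>2 * (W (n - m))\<^sup>2 * (x (n - m) - x n)"
      using ward_identity[of "n - m" n] assms by (simp add: mult_2)
    have e3: "W (2 * n + m) * W (2 * n - m) = (W (2 * n))\<^sup>2 * (W m)\<^sup>2 * (x m - x (2 * n))"
      using ward_identity[of m "2 * n"] assms by simp
    have "(x n - x m)\<^sup>2 * ((x (n + m) - x n) * (x (n - m) - x n)) * (W n ^ 8 * W m ^ 4)
      = - ((W (n + m) * W (n - m))\<^sup>2 * W n ^ 4 * ((x n - x (n + m)) * (x (n - m) - x n)))"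
      unfolding nm by Groebner_Basis.algebra
    also have "\<dots> = - ((W (2 * n + m) * W m) * (W (2 * n - m) * W m))"
      unfolding e1 e2 by Groebner_Basis.algebra
    also have "\<dots> = - (W (2 * n + m) * W (2 * n - m)) * (W m)\<^sup>2"
      by Groebner_Basis.algebra
    also have "\<dots> = (h n)\<^sup>2 * (x (2 * n) - x m) * (W n ^ 8 * W m ^ 4)"
      unfolding e3 h_eq[OF n(2), symmetric] by Groebner_Basis.algebra
    finally have "(x n - x m)\<^sup>2 * ((x (n + m) - x n) * (x (n - m) - x n)) = G (x n) (x n) (x m)"
      unfolding G_double[OF n(2)] using nz by simp
    then show ?thesis by (metis quad_form_rotate quad_form_swap)
  qed
  define p q where "p = (x n - x m)\<^sup>2 * (x (n + m) + x (n - m)) - ((x n + x m) * (b4 + 2 * x n * x m) + b2 * x n * x m + b6)"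
    and "q = ((x n)\<^sup>2 * (x m)\<^sup>2 - b4 * x n * x m - b6 * (x n + x m) - b8) - (x n - x m)\<^sup>2 * (x (n + m) * x (n - m))"
  have diff: "G (x n) (x m) t - (x n - x m)\<^sup>2 * ((x (n + m) - t) * (x (n - m) - t)) = p * t + q" for t
    unfolding quad_form_def p_def q_def by Groebner_Basis.algebra
  have "p * (x n - x 1) = 0"
    using diff[of "x n"] diff[of "x 1"] at_one at_n by Groebner_Basis.algebra
  then have p: "p = 0" using x_neq[OF n(1)] by simp
  then have "q = 0" using diff[of "x 1"] at_one by simp
  then show ?thesis using diff[of t] p by simp
qed

section \<open>The third and fourth terms as polynomials in x_1\<close>

lemma W_three: "W 3 = 3 * x 1 ^ 4 + b2 * x 1 ^ 3 + 3 * b4 * (x 1)\<^sup>2 + 3 * b6 * x 1 + b8"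
proof -
  have "W 3 = (x 1 - x 2) * (h 1)\<^sup>2" by (simp add: numeral_eq_Suc)
  then show ?thesis using x_two h_square[of 1] by simp Groebner_Basis.algebra
qed

lemma W_four:
  "W 4 = h 1 * (2 * x 1 ^ 6 + b2 * x 1 ^ 5 + 5 * b4 * x 1 ^ 4 + 10 * b6 * x 1 ^ 3 + 10 * b8 * (x 1)\<^sup>2
            + (b2 * b8 - b4 * b6) * x 1 + (b4 * b8 - b6\<^sup>2))" (is "_ = h 1 * ?r")
proof -
  have 4: "W 4 * h 1 = (x 1 - x 3) * (W 3)\<^sup>2"
    using W_step[of 3] by (simp add: numeral_2_eq_2)
  have 3: "W 3 = (x 1 - x 2) * (h 1)\<^sup>2" by (simp add: numeral_eq_Suc)
  have s: "(x 3 + x 1) * (x 2 - x 1)\<^sup>2 = (x 2 + x 1) * (b4 + 2 * x 2 * x 1) + b2 * x 2 * x 1 + b6"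
    using x_sum[of 2] by simp
  \<comment> \<open>Eliminating x_2 in favour of d pays off because d h_1^2 is W_3, so that d can be
    traded for the polynomial in \<open>W_three\<close>.\<close>
  define d where "d = x 1 - x 2"
  have 3: "W 3 = d * (h 1)\<^sup>2" unfolding 3 d_def ..
  have x2: "x 2 = x 1 - d" by (simp add: d_def)
  have hs: "(h 1)\<^sup>2 = 4 * x 1 ^ 3 + b2 * (x 1)\<^sup>2 + 2 * b4 * x 1 + b6" using h_square[of 1] by simp
  have s': "(x 1 - x 3) * d\<^sup>2 = d * (6 * (x 1)\<^sup>2 + b2 * x 1 + b4) - (h 1)\<^sup>2"
    using s hs unfolding x2 by Groebner_Basis.algebra
  have "W 4 * h 1 = ((x 1 - x 3) * d\<^sup>2) * (h 1)^4"
    unfolding 4 3 by Groebner_Basis.algebra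
  also have "\<dots> = (h 1)\<^sup>2 * (W 3 * (6 * (x 1)\<^sup>2 + b2 * x 1 + b4) - (h 1)^4)"
    unfolding s' 3 by Groebner_Basis.algebra
  also have "W 3 * (6 * (x 1)\<^sup>2 + b2 * x 1 + b4) - (h 1)^4 = ?r"
  proof -
    have "W 3 * (6 * (x 1)\<^sup>2 + b2 * x 1 + b4) - ((h 1)\<^sup>2)\<^sup>2 = ?r - (x 1)\<^sup>2 * (4 * b8 - (b2 * b6 - b4\<^sup>2))"
      unfolding W_three hs by Groebner_Basis.algebra
    then show ?thesis using b8 by simp
  qed
  finally show ?thesis using h_one_nonzero by (simp add: power2_eq_square)
qed

end

subsection \<open>Weierstrass equations over types and ring records\<close>

text \<open>Carries computations in type-class rings over to ring records. The source is only a
  domain and injectivity is not demanded, so that reduction of integers modulo p is an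
  instance.\<close>

locale ring_hom_from_type = cring R for R :: "('b, 'm) ring_scheme" (structure) +
  fixes f :: "'a::idom \<Rightarrow> 'b"
  assumes f_closed: "f u \<in> carrier R"
    and f_add: "f (u + v) = f u \<oplus> f v"
    and f_mult: "f (u * v) = f u \<otimes> f v"
    and f_one: "f 1 = \<one>"
begin

lemma f_zero: "f 0 = \<zero>"
proof -
  have "f 0 \<oplus> f 0 = f 0" using f_add[of 0 0] by simp
  then show ?thesis using f_closed by (metis add.l_cancel_one')
qed

lemma f_uminus: "f (- u) = \<ominus> f u"
  using f_add[of "- u" u] f_zero f_closed by (simp add: minus_equality)

lemma f_diff: "f (u - v) = f u \<ominus> f v"
  using f_add[of u "- v"] by (simp add: f_uminus minus_eq)

lemma f_power: "f (u ^ n) = f u [^] n"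
  by (induction n) (simp_all add: f_one f_mult m_comm f_closed)

lemma f_of_nat: "f (of_nat k) = [k] \<cdot> \<one>"
proof (induction k)
  case (Suc k)
  have "f (of_nat (Suc k)) = f (of_nat k) \<oplus> \<one>"
    using f_add[of "of_nat k" 1] by (simp add: f_one add.commute)
  then show ?case using Suc by (simp add: add_pow_def)
qed (simp add: f_zero add_pow_def)

lemma f_of_int: "f (of_int k) = [k] \<cdot> \<one>"
proof (cases "k \<ge> 0")
  case True
  then show ?thesis using f_of_nat[of "nat k"] by (simp add: add_pow_int_ge)
next
  case False
  then show ?thesis using f_of_nat[of "nat (- k)"] f_uminus[of "of_int (- k)"]
    by (simp add: add_pow_int_lt)
qed

lemma f_numeral: "f (numeral k) = [(numeral k :: int)] \<cdot> \<one>"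
  using f_of_int[of "numeral k"] by simp

end


text \<open>Type-class versions of the curve equation and group law, which the homomorphisms above carry
  to the record versions over \<open>\<rat>\<close>, \<open>\<rat>\<^sub>p\<close> and \<open>\<int>/p\<close>.\<close>

definition weq :: "weierstrass \<Rightarrow> 'a::idom \<Rightarrow> 'a \<Rightarrow> bool" where
  "weq E x y \<longleftrightarrow> y\<^sup>2 + of_int (a\<^sub>1 E) * x * y + of_int (a\<^sub>3 E) * y =
     x ^ 3 + of_int (a\<^sub>2 E) * x\<^sup>2 + of_int (a\<^sub>4 E) * x + of_int (a\<^sub>6 E)"

definition wdx :: "weierstrass \<Rightarrow> 'a::idom \<Rightarrow> 'a \<Rightarrow> 'a" where
  "wdx E x y = of_int (a\<^sub>1 E) * y - (3 * x\<^sup>2 + of_int (2 * a\<^sub>2 E) * x + of_int (a\<^sub>4 E))"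

definition wdy :: "weierstrass \<Rightarrow> 'a::idom \<Rightarrow> 'a \<Rightarrow> 'a" where
  "wdy E x y = 2 * y + of_int (a\<^sub>1 E) * x + of_int (a\<^sub>3 E)"

definition wslope :: "weierstrass \<Rightarrow> 'a::field \<Rightarrow> 'a \<Rightarrow> 'a \<Rightarrow> 'a \<Rightarrow> 'a" where
  "wslope E x1 y1 x2 y2 = (if x1 = x2 then - wdx E x1 y1 / wdy E x1 y1 else (y2 - y1) / (x2 - x1))"

fun wadd :: "weierstrass \<Rightarrow> 'a::field point \<Rightarrow> 'a point \<Rightarrow> 'a point" where
  "wadd E Infinity Q = Q"
| "wadd E (Affine x1 y1) Infinity = Affine x1 y1"
| "wadd E (Affine x1 y1) (Affine x2 y2) =
     (if x1 = x2 \<and> y1 + y2 + of_int (a\<^sub>1 E) * x1 + of_int (a\<^sub>3 E) = 0 then Infinity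
      else let l = wslope E x1 y1 x2 y2;
               x3 = l\<^sup>2 + of_int (a\<^sub>1 E) * l - of_int (a\<^sub>2 E) - x1 - x2
           in Affine x3 (l * (x1 - x3) - y1 - of_int (a\<^sub>1 E) * x3 - of_int (a\<^sub>3 E)))"

fun wpoint :: "weierstrass \<Rightarrow> 'a::idom point \<Rightarrow> bool" where
  "wpoint E Infinity = True"
| "wpoint E (Affine x y) = weq E x y"

section \<open>Closure of the curve under addition\<close>

lemma same_x:
  assumes "weq E x y" "weq E x y'"
  shows "y = y' \<or> y + y' + of_int (a\<^sub>1 E) * x + of_int (a\<^sub>3 E) = 0"
proof -
  have "(y - y') * (y + y' + of_int (a\<^sub>1 E) * x + of_int (a\<^sub>3 E)) = 0"
    using assms unfolding weq_def by Groebner_Basis.algebra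
  then show ?thesis by simp
qed

lemma wdy_nonzero:
  assumes "weq E x y" "weq E x y'" "y + y' + of_int (a\<^sub>1 E) * x + of_int (a\<^sub>3 E) \<noteq> 0"
  shows "wdy E x y \<noteq> 0"
  using same_x[OF assms(1,2)] assms(3) by (auto simp: wdy_def)

text \<open>On the line y = l t + v the curve equation becomes a monic cubic c. The choice of x3
  leaves c(t) = (t - x1)(t - x2)(t - x3) + p t + q. This remainder vanishes at x1, and p = 0 follows
  from the second point, or from the tangent slope if x1 = x2. The new point is the opposite of the
  third intersection.\<close>

lemma weq_third_point:
  fixes l x1 y1 x2 y2 :: "'a::field"
  assumes 1: "weq E x1 y1" and 2: "weq E x2 y2"
    and ne: "\<not> (x1 = x2 \<and> y1 + y2 + of_int (a\<^sub>1 E) * x1 + of_int (a\<^sub>3 E) = 0)"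
    and l: "l = wslope E x1 y1 x2 y2"
    and x3: "x3 = l\<^sup>2 + of_int (a\<^sub>1 E) * l - of_int (a\<^sub>2 E) - x1 - x2"
  shows "weq E x3 (l * (x1 - x3) - y1 - of_int (a\<^sub>1 E) * x3 - of_int (a\<^sub>3 E))"
proof -
  define A1 A2 A3 A4 A6 :: 'a where A: "A1 = of_int (a\<^sub>1 E)" "A2 = of_int (a\<^sub>2 E)" "A3 = of_int (a\<^sub>3 E)" "A4 = of_int (a\<^sub>4 E)" "A6 = of_int (a\<^sub>6 E)"
  define v where "v = y1 - l * x1"
  define c where "c = (\<lambda>t. t^3 + A2 * t\<^sup>2 + A4 * t + A6 - (l * t + v)\<^sup>2 - A1 * t * (l * t + v) - A3 * (l * t + v))"
  define p where "p = A4 - 2 * l * v - A1 * v - A3 * l - (x1 * x2 + x1 * x3 + x2 * x3)"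
  define q where "q = A6 - v\<^sup>2 - A3 * v + x1 * x2 * x3"
  have c_eq: "c t = (t - x1) * (t - x2) * (t - x3) + p * t + q" for t
    using x3 unfolding c_def p_def q_def A[symmetric] by Groebner_Basis.algebra
  have c1: "p * x1 + q = 0"
    using c_eq[of x1] 1 unfolding c_def v_def weq_def A[symmetric] by Groebner_Basis.algebra
  have "p = 0"
  proof (cases "x1 = x2")
    case False
    then have "l * (x2 - x1) = y2 - y1" using l by (simp add: wslope_def)
    then have "p * x2 + q = 0"
      using c_eq[of x2] 2 unfolding c_def v_def weq_def A[symmetric] by Groebner_Basis.algebra
    then have "p * (x2 - x1) = 0" using c1 by Groebner_Basis.algebra
    then show ?thesis using False by simp
  next
    case True
    then have "wdy E x1 y1 \<noteq> 0" using wdy_nonzero[of E x1 y1 y2] 1 2 ne by auto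
    then have "l * wdy E x1 y1 = - wdx E x1 y1" using l True by (simp add: wslope_def)
    then have "l * (2 * y1 + A1 * x1 + A3) = - (A1 * y1 - (3 * x1\<^sup>2 + 2 * A2 * x1 + A4))"
      by (simp add: wdx_def wdy_def A)
    then show ?thesis
      using x3 unfolding p_def v_def A[symmetric] True[symmetric] by Groebner_Basis.algebra
  qed
  then have "c x3 = 0" using c_eq[of x3] c1 by simp
  then show ?thesis unfolding weq_def A[symmetric] c_def v_def by Groebner_Basis.algebra
qed

lemma wpoint_wadd: "wpoint E P \<Longrightarrow> wpoint E Q \<Longrightarrow> wpoint E (wadd E P Q)"
proof (cases P; cases Q)
  fix x1 y1 x2 y2
  assume "P = Affine x1 y1" "Q = Affine x2 y2" "wpoint E P" "wpoint E Q"
  then show ?thesis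
    using weq_third_point[of E x1 y1 x2 y2, OF _ _ _ refl refl] by (simp add: Let_def)
qed auto

section \<open>Transfer of the curve and its group law along homomorphisms\<close>

context ring_hom_from_type
begin

lemma curve_dx_hom: "curve_dx R E (f u) (f v) = f (wdx E u v)"
  by (simp only: curve_dx_def wdx_def f_diff f_add f_mult f_power f_of_int f_numeral)

lemma curve_dy_hom: "curve_dy R E (f u) (f v) = f (wdy E u v)"
  by (simp only: curve_dy_def wdy_def f_add f_mult f_of_int f_numeral)

lemma on_curve_hom:
  "on_curve R E (f u) (f v) \<longleftrightarrow>
   f (v\<^sup>2 + of_int (a\<^sub>1 E) * u * v + of_int (a\<^sub>3 E) * v) =
   f (u ^ 3 + of_int (a\<^sub>2 E) * u\<^sup>2 + of_int (a\<^sub>4 E) * u + of_int (a\<^sub>6 E))"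
  by (simp only: on_curve_def f_add f_mult f_power f_of_int)

end

locale field_hom_from_type = ring_hom_from_type R f
  for R :: "('b, 'm) ring_scheme" (structure) and f :: "'a::field \<Rightarrow> 'b" +
  assumes one_neq_zero: "\<one> \<noteq> \<zero>"
begin

lemma f_inverse:
  assumes "u \<noteq> 0"
  shows "inv (f u) = f (inverse u)"
  using f_mult[of u "inverse u"] assms by (intro comm_inv_char) (auto simp: f_closed f_one)

lemma f_eq_zero_iff: "f u = \<zero> \<longleftrightarrow> u = 0"
  using f_mult[of u "inverse u"] one_neq_zero by (cases "u = 0") (auto simp: f_zero f_one f_closed)

lemma f_eq_iff: "f u = f v \<longleftrightarrow> u = v"
  using f_eq_zero_iff[of "u - v"] f_closed by (simp add: f_diff)

text \<open>The tangent case has to exclude a zero denominator: \<open>inverse 0\<close> is 0 in a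
  type-class field, whereas \<open>inv\<close> of zero in a ring record is unspecified.\<close>

lemma slope_hom:
  assumes "x1 = x2 \<Longrightarrow> wdy E x1 y1 \<noteq> 0"
  shows "slope R E (f x1) (f y1) (f x2) (f y2) = f (wslope E x1 y1 x2 y2)"
proof (cases "x1 = x2")
  case True
  have "slope R E (f x1) (f y1) (f x2) (f y2) = f (- wdx E x1 y1) \<otimes> f (inverse (wdy E x1 y1))"
    using f_inverse[OF assms[OF True]] True by (simp add: slope_def curve_dx_hom curve_dy_hom f_uminus)
  then show ?thesis using True by (simp only: wslope_def refl if_True divide_inverse f_mult)
next
  case False
  have "slope R E (f x1) (f y1) (f x2) (f y2) = f (y2 - y1) \<otimes> f (inverse (x2 - x1))"
    using f_inverse[of "x2 - x1"] False by (simp add: slope_def f_eq_iff f_diff)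
  then show ?thesis using False by (simp add: wslope_def divide_inverse f_mult)
qed

lemma point_add_hom:
  assumes "wpoint E P" "wpoint E Q"
  shows "point_add R E (map_point f P) (map_point f Q) = map_point f (wadd E P Q)"
proof (cases P; cases Q)
  fix x1 y1 x2 y2
  assume PQ: "P = Affine x1 y1" "Q = Affine x2 y2"
  have opp: "f y1 \<oplus> f y2 \<oplus> [a\<^sub>1 E] \<cdot> \<one> \<otimes> f x1 \<oplus> [a\<^sub>3 E] \<cdot> \<one> = \<zero> \<longleftrightarrow> y1 + y2 + of_int (a\<^sub>1 E) * x1 + of_int (a\<^sub>3 E) = 0"
    by (simp add: f_add f_mult flip: f_of_int f_eq_zero_iff)
  have iff: "f x1 = f x2 \<and> f y1 \<oplus> f y2 \<oplus> [a\<^sub>1 E] \<cdot> \<one> \<otimes> f x1 \<oplus> [a\<^sub>3 E] \<cdot> \<one> = \<zero>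
      \<longleftrightarrow> x1 = x2 \<and> y1 + y2 + of_int (a\<^sub>1 E) * x1 + of_int (a\<^sub>3 E) = 0"
    unfolding opp f_eq_iff ..
  show ?thesis
  proof (cases "x1 = x2 \<and> y1 + y2 + of_int (a\<^sub>1 E) * x1 + of_int (a\<^sub>3 E) = 0")
    case True
    show ?thesis unfolding PQ point.map point_add.simps wadd.simps iff if_P[OF True] ..
  next
    case False
    then have sl: "slope R E (f x1) (f y1) (f x2) (f y2) = f (wslope E x1 y1 x2 y2)"
      using assms PQ wdy_nonzero[of E x1 y1 y2] by (intro slope_hom) auto
    show ?thesis
      unfolding PQ point.map point_add.simps wadd.simps iff if_not_P[OF False] sl Let_def
        f_add f_mult f_diff f_power f_of_int ..
  qed
qed auto

end

subsection \<open>Multiples of a point of infinite order\<close>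

text \<open>P is added on the right, as in \<open>[^]\<close>, so that
  \<open>curve_group_pow_hom\<close> is a plain induction.\<close>

primrec wmult :: "weierstrass \<Rightarrow> 'a::field point \<Rightarrow> nat \<Rightarrow> 'a point" where
  "wmult E P 0 = Infinity"
| "wmult E P (Suc n) = wadd E (wmult E P n) P"

lemma wpoint_wmult: "wpoint E P \<Longrightarrow> wpoint E (wmult E P n)"
  by (induction n) (auto intro: wpoint_wadd)

lemma (in field_hom_from_type) curve_group_pow_hom:
  assumes "wpoint E P"
  shows "map_point f P [^]\<^bsub>curve_group R E\<^esub> n = map_point f (wmult E P n)"
proof (induction n)
  case 0
  then show ?case by (simp add: nat_pow_def curve_group_def)
next
  case (Suc n)
  have "map_point f P [^]\<^bsub>curve_group R E\<^esub> Suc n =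
      point_add R E (map_point f P [^]\<^bsub>curve_group R E\<^esub> n) (map_point f P)"
    by (simp add: nat_pow_def curve_group_def)
  then show ?case using Suc point_add_hom[OF wpoint_wmult[OF assms] assms] by simp
qed

text \<open>Unspecified at \<^const>\<open>Infinity\<close>.\<close>

fun xcoord :: "'a point \<Rightarrow> 'a" where "xcoord (Affine x y) = x"
fun ycoord :: "'a point \<Rightarrow> 'a" where "ycoord (Affine x y) = y"

locale point_of_infinite_order =
  fixes E :: weierstrass and P :: "'a::field point"
  assumes P: "wpoint E P" and infinite_order: "n \<ge> 1 \<Longrightarrow> wmult E P n \<noteq> Infinity"
begin

definition "x n = xcoord (wmult E P n)"
definition "y n = ycoord (wmult E P n)"
definition "h n = wdy E (x n) (y n)"

abbreviation "A1 \<equiv> of_int (a\<^sub>1 E) :: 'a"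
abbreviation "A2 \<equiv> of_int (a\<^sub>2 E) :: 'a"
abbreviation "A3 \<equiv> of_int (a\<^sub>3 E) :: 'a"
abbreviation "A4 \<equiv> of_int (a\<^sub>4 E) :: 'a"
abbreviation "A6 \<equiv> of_int (a\<^sub>6 E) :: 'a"

lemma wmult_eq: "n \<ge> 1 \<Longrightarrow> wmult E P n = Affine (x n) (y n)"
  using infinite_order[of n] by (cases "wmult E P n") (auto simp: x_def y_def)

lemma P_eq: "P = Affine (x 1) (y 1)"
  using wmult_eq[of 1] by simp

lemma weq_mult: "n \<ge> 1 \<Longrightarrow> weq E (x n) (y n)"
  using wpoint_wmult[OF P, of n] wmult_eq[of n] by simp

lemma add_step:
  assumes "n \<ge> 1"
  defines "l \<equiv> wslope E (x n) (y n) (x 1) (y 1)"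
  shows "\<not> (x n = x 1 \<and> y n + y 1 + A1 * x n + A3 = 0)"
    and "x (n + 1) = l\<^sup>2 + A1 * l - A2 - x n - x 1"
    and "y (n + 1) = l * (x n - x (n + 1)) - y n - A1 * x (n + 1) - A3"
proof -
  have s: "wadd E (Affine (x n) (y n)) (Affine (x 1) (y 1)) = Affine (x (n + 1)) (y (n + 1))"
    using wmult_eq[of n] wmult_eq[of "n + 1"] assms P_eq by simp
  then show ne: "\<not> (x n = x 1 \<and> y n + y 1 + A1 * x n + A3 = 0)"
    by (auto split: if_splits)
  show 2: "x (n + 1) = l\<^sup>2 + A1 * l - A2 - x n - x 1"
    using s unfolding wadd.simps if_not_P[OF ne] Let_def l_def[symmetric] point.inject by simp
  show "y (n + 1) = l * (x n - x (n + 1)) - y n - A1 * x (n + 1) - A3"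
    using s unfolding wadd.simps if_not_P[OF ne] Let_def l_def[symmetric] point.inject 2 by simp
qed

text \<open>Written without division, the slope equation covers the tangent too: if x_n = x_1, then
  nP = -P is excluded, so y_n = y_1 and both sides are 0.\<close>

lemma slope_P:
  assumes "n \<ge> 1"
  defines "l \<equiv> wslope E (x n) (y n) (x 1) (y 1)"
  shows "l * (x n - x 1) = y n - y 1"
proof (cases "x n = x 1")
  case True
  then show ?thesis using same_x[of E "x n" "y n" "y 1"] weq_mult[OF assms(1)] weq_mult[of 1] add_step(1)[OF assms(1)]
    by simp
next
  case False
  then have "l * (x 1 - x n) = y 1 - y n" by (simp add: l_def wslope_def)
  then show ?thesis by Groebner_Basis.algebra
qed

text \<open>-nP lies on the line through (n - 1)P and P. If x_n = x_1, this line meets the vertical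
  through P only in P, so nP = -P and (n + 1)P would be O.\<close>

lemma x_neq:
  assumes "n \<ge> 2"
  shows "x n \<noteq> x 1"
proof
  assume eq: "x n = x 1"
  define k where "k = n - 1"
  have k: "k \<ge> 1" "n = k + 1" using assms by (auto simp: k_def)
  have "y n + y 1 + A1 * x n + A3 = 0"
    using add_step(3)[OF k(1)] slope_P[OF k(1)] eq unfolding k(2) by Groebner_Basis.algebra
  then show False using add_step(1)[of n] eq assms by simp
qed

lemma h_one_nonzero: "h 1 \<noteq> 0"
  using add_step(1)[of 1] by (auto simp: h_def wdy_def)

text \<open>Here l is the slope of the line through nP and P. The line through (n - 1)P and P, of
  slope k, also contains -nP; read as the line through -nP and P, it gives x_{n-1} the shape of x(nP
  - P).\<close>

lemma neighbours:
  assumes "n \<ge> 2"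
  obtains l k where "l * (x n - x 1) = y n - y 1" "k * (x n - x 1) = - (y n + y 1 + A1 * x n + A3)"
    "x (n + 1) = l\<^sup>2 + A1 * l - A2 - x n - x 1" "x (n - 1) = k\<^sup>2 + A1 * k - A2 - x n - x 1"
proof -
  have n: "n \<ge> 1" "n - 1 \<ge> 1" "n - 1 + 1 = n" using assms by auto
  define k where "k = wslope E (x (n - 1)) (y (n - 1)) (x 1) (y 1)"
  have k: "x n = k\<^sup>2 + A1 * k - A2 - x (n - 1) - x 1" "y n = k * (x (n - 1) - x n) - y (n - 1) - A1 * x n - A3"
      "k * (x (n - 1) - x 1) = y (n - 1) - y 1"
    using add_step(2,3)[OF n(2)] slope_P[OF n(2)] unfolding n(3) k_def by blast+
  have "k * (x n - x 1) = - (y n + y 1 + A1 * x n + A3)"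
    using k(2,3) by Groebner_Basis.algebra
  moreover have "x (n - 1) = k\<^sup>2 + A1 * k - A2 - x n - x 1" using k(1) by (simp add: algebra_simps)
  ultimately show thesis using slope_P[OF n(1)] add_step(2)[OF n(1)] that by blast
qed

lemma b_of_int:
  "of_int (b\<^sub>2 E) = A1\<^sup>2 + 4 * A2" "of_int (b\<^sub>4 E) = 2 * A4 + A1 * A3" "of_int (b\<^sub>6 E) = A3\<^sup>2 + 4 * A6"
  "of_int (b\<^sub>8 E) = A1\<^sup>2 * A6 + 4 * A2 * A6 - A1 * A3 * A4 + A2 * A3\<^sup>2 - A4\<^sup>2"
  by (simp_all add: b\<^sub>2_def b\<^sub>4_def b\<^sub>6_def b\<^sub>8_def)

sublocale x_multiples "of_int (b\<^sub>2 E)" "of_int (b\<^sub>4 E)" "of_int (b\<^sub>6 E)" "of_int (b\<^sub>8 E)" x h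
proof
  show "4 * of_int (b\<^sub>8 E) = of_int (b\<^sub>2 E) * of_int (b\<^sub>6 E) - (of_int (b\<^sub>4 E) :: 'a)\<^sup>2"
    unfolding b_of_int by Groebner_Basis.algebra
  show "(h n)\<^sup>2 = 4 * x n ^ 3 + of_int (b\<^sub>2 E) * (x n)\<^sup>2 + 2 * of_int (b\<^sub>4 E) * x n + of_int (b\<^sub>6 E)" if "n \<ge> 1" for n
    using weq_mult[OF that] unfolding b_of_int h_def wdy_def weq_def by Groebner_Basis.algebra
  show "(h 1)\<^sup>2 * x 2 = x 1 ^ 4 - of_int (b\<^sub>4 E) * (x 1)\<^sup>2 - 2 * of_int (b\<^sub>6 E) * x 1 - of_int (b\<^sub>8 E)"
  proof -
    define l where "l = wslope E (x 1) (y 1) (x 1) (y 1)"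
    have l: "l * h 1 = - wdx E (x 1) (y 1)"
      using h_one_nonzero by (simp add: l_def wslope_def h_def)
    have "x 2 = l\<^sup>2 + A1 * l - A2 - x 1 - x 1"
      using add_step(2)[of 1] by (simp add: l_def numeral_2_eq_2)
    then have "(h 1)\<^sup>2 * x 2 = (l * h 1)\<^sup>2 + A1 * (l * h 1) * h 1 - (A2 + 2 * x 1) * (h 1)\<^sup>2"
      by Groebner_Basis.algebra
    also have "\<dots> = x 1 ^ 4 - of_int (b\<^sub>4 E) * (x 1)\<^sup>2 - 2 * of_int (b\<^sub>6 E) * x 1 - of_int (b\<^sub>8 E)"
      using weq_mult[OF order.refl] unfolding l unfolding b_of_int h_def wdy_def wdx_def weq_def of_int_mult of_int_numeral by Groebner_Basis.algebra
    finally show ?thesis .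
  qed
  show "h 1 \<noteq> 0" by (rule h_one_nonzero)
  show "x n \<noteq> x 1" if "n \<ge> 2" for n by (rule x_neq[OF that])
  fix n :: nat assume n: "n \<ge> 2"
  obtain l k where lk: "l * (x n - x 1) = y n - y 1" "k * (x n - x 1) = - (y n + y 1 + A1 * x n + A3)"
    "x (n + 1) = l\<^sup>2 + A1 * l - A2 - x n - x 1" "x (n - 1) = k\<^sup>2 + A1 * k - A2 - x n - x 1"
    using neighbours[OF n] .
  define D where "D = x n - x 1"
  have D: "x n = x 1 + D" "D \<noteq> 0" using x_neq[OF n] by (simp_all add: D_def)
  have e1: "weq E (x 1) (y 1)" and e2: "weq E (x n) (y n)" using weq_mult n by auto
  have p: "x (n + 1) * D\<^sup>2 = (y n - y 1)\<^sup>2 + A1 * (y n - y 1) * D - (A2 + x n + x 1) * D\<^sup>2"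
    using lk(1,3) unfolding D_def by Groebner_Basis.algebra
  have m: "x (n - 1) * D\<^sup>2 = (y n + y 1 + A1 * x n + A3)\<^sup>2 - A1 * (y n + y 1 + A1 * x n + A3) * D - (A2 + x n + x 1) * D\<^sup>2"
    using lk(2,4) unfolding D_def by Groebner_Basis.algebra
  show "(x (n + 1) + x (n - 1)) * (x n - x 1)\<^sup>2 =
       (x n + x 1) * (of_int (b\<^sub>4 E) + 2 * x n * x 1) + of_int (b\<^sub>2 E) * x n * x 1 + of_int (b\<^sub>6 E)"
    using p m e1 e2 unfolding b_of_int weq_def D_def by Groebner_Basis.algebra
  show "(x (n - 1) - x (n + 1)) * (x n - x 1)\<^sup>2 = h n * h 1"
    using p m unfolding D_def h_def wdy_def by Groebner_Basis.algebra
  \<comment> \<open>Multiplying \<open>p\<close> and \<open>m\<close> yields the product formula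
    with a surplus factor D^2, which cancels since x_n and x_1 differ.\<close>
  have "(x (n + 1) * D\<^sup>2) * (x (n - 1) * D\<^sup>2) =
      D\<^sup>2 * ((x n)\<^sup>2 * (x 1)\<^sup>2 - of_int (b\<^sub>4 E) * x n * x 1 - of_int (b\<^sub>6 E) * (x n + x 1) - of_int (b\<^sub>8 E))"
    unfolding p m using e1 e2 unfolding D_def b_of_int weq_def by Groebner_Basis.algebra
  then show "x (n + 1) * x (n - 1) * (x n - x 1)\<^sup>2 =
       (x n)\<^sup>2 * (x 1)\<^sup>2 - of_int (b\<^sub>4 E) * x n * x 1 - of_int (b\<^sub>6 E) * (x n + x 1) - of_int (b\<^sub>8 E)"
    using D(2) unfolding D_def[symmetric] by (simp add: power2_eq_square mult.assoc mult.left_commute)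
qed

end

subsection \<open>Division polynomials\<close>

lemma psi_small:
  "psi E 0 = 0" "psi E 1 = 1" "psi E 2 = psi2 E"
  "psi E 3 = [:[:b\<^sub>8 E, 3 * b\<^sub>6 E, 3 * b\<^sub>4 E, b\<^sub>2 E, 3:]:]"
  "psi E 4 = psi2 E * [:[:b\<^sub>4 E * b\<^sub>8 E - (b\<^sub>6 E)\<^sup>2, b\<^sub>2 E * b\<^sub>8 E - b\<^sub>4 E * b\<^sub>6 E, 10 * b\<^sub>8 E,
                    10 * b\<^sub>6 E, 5 * b\<^sub>4 E, b\<^sub>2 E, 2:]:]"
  by (subst psi.simps, simp)+

lemma psi_odd:
  assumes "k \<ge> 2"
  shows "psi E (2 * k + 1) = psi E (k + 2) * psi E k ^ 3 - psi E (k - 1) * psi E (k + 1) ^ 3"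
proof -
  have "2 * k + 1 \<noteq> 0" "2 * k + 1 \<noteq> 1" "2 * k + 1 \<noteq> 2" "2 * k + 1 \<noteq> 3" "2 * k + 1 \<noteq> 4"
    "(2 * k + 1) div 2 = k" "odd (2 * k + 1)"
    using assms by presburger+
  then show ?thesis by (subst psi.simps) (simp only: if_False if_True Let_def not_False_eq_True)
qed

definition psi_even_numerator where
  "psi_even_numerator E k = psi E k * psi E (k + 2) * (psi E (k - 1))\<^sup>2 - psi E k * psi E (k - 2) * (psi E (k + 1))\<^sup>2"

lemma psi_even:
  assumes "k \<ge> 3"
  shows "psi E (2 * k) = psi_even_numerator E k div psi2 E"
proof -
  have "2 * k \<noteq> 0" "2 * k \<noteq> 1" "2 * k \<noteq> 2" "2 * k \<noteq> 3" "2 * k \<noteq> 4"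
    "(2 * k) div 2 = k" "\<not> odd (2 * k)"
    using assms by presburger+
  then show ?thesis by (subst psi.simps) (simp only: if_False if_True Let_def psi_even_numerator_def)
qed

lemma psi2_nonzero: "psi2 E \<noteq> 0"
  by (simp add: psi2_def)

text \<open>For even k, psi_2 divides psi_k and psi_{k+2}, psi_{k-2}; for odd k it divides psi_{k+1}
  and psi_{k-1}, which occur squared. One factor is used up by \<open>div\<close>, the other keeps
  the induction going.\<close>

lemma psi2_dvd_numerator:
  assumes "k \<ge> 3" and IH: "\<And>j. j < 2 * k \<Longrightarrow> even j \<Longrightarrow> psi2 E dvd psi E j"
  shows "psi2 E * psi2 E dvd psi_even_numerator E k"
proof (cases "even k")
  case True
  then have "psi2 E dvd psi E k" "psi2 E dvd psi E (k + 2)" "psi2 E dvd psi E (k - 2)"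
    using assms by (auto intro!: IH)
  then show ?thesis unfolding psi_even_numerator_def
    by (intro dvd_diff dvd_mult2[OF mult_dvd_mono])
next
  case False
  then have "psi2 E dvd psi E (k + 1)" "psi2 E dvd psi E (k - 1)"
    using assms by (auto intro!: IH)
  then show ?thesis unfolding psi_even_numerator_def power2_eq_square
    by (intro dvd_diff dvd_mult[OF mult_dvd_mono])
qed

lemma psi2_dvd_psi: "even n \<Longrightarrow> psi2 E dvd psi E n"
proof (induction n rule: less_induct)
  case (less n)
  then obtain k where k: "n = 2 * k" by auto
  consider "k = 0" | "k = 1" | "k = 2" | "k \<ge> 3" by linarith
  then show ?case
  proof cases
    case 4
    then have "psi2 E * psi2 E dvd psi_even_numerator E k"
      using less.IH k by (intro psi2_dvd_numerator) auto
    then obtain q where "psi_even_numerator E k = psi2 E * (psi2 E * q)"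
      by (metis dvdE mult.assoc)
    then show ?thesis using 4 k psi2_nonzero[of E] by (simp add: psi_even)
  qed (use k psi_small[of E] in \<open>auto intro: dvd_smult\<close>)
qed

text \<open>The \<open>div\<close> in the recursion of \<open>psi\<close> is exact by
  \<open>psi2_dvd_numerator\<close>.\<close>

lemma psi_even_mult:
  assumes "k \<ge> 3"
  shows "psi E (2 * k) * psi2 E =
    psi E k * psi E (k + 2) * (psi E (k - 1))\<^sup>2 - psi E k * psi E (k - 2) * (psi E (k + 1))\<^sup>2"
proof -
  have "psi2 E dvd psi_even_numerator E k"
    using psi2_dvd_numerator[OF assms psi2_dvd_psi, of E] dvd_mult_left by blast
  then show ?thesis
    unfolding psi_even[OF assms] psi_even_numerator_def[symmetric] by simp
qed

section \<open>Evaluation of polynomials along ring homomorphisms\<close>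

locale comm_ring_map =
  fixes f :: "'a::comm_ring_1 \<Rightarrow> 'b::comm_ring_1"
  assumes add: "f (u + v) = f u + f v" and mult: "f (u * v) = f u * f v" and one: "f 1 = 1"
begin

lemma zero: "f 0 = 0"
  using add[of 0 0] by simp

lemma poly_map_add: "poly (map_poly f (p + q)) t = poly (map_poly f p) t + poly (map_poly f q) t"
proof -
  have "map_poly f (p + q) = map_poly f p + map_poly f q"
    by (rule poly_eqI) (simp add: coeff_map_poly zero add)
  then show ?thesis by simp
qed

lemma poly_map_smult: "poly (map_poly f (smult a q)) t = f a * poly (map_poly f q) t"
proof -
  have "map_poly f (smult a q) = smult (f a) (map_poly f q)"
    by (rule poly_eqI) (simp add: coeff_map_poly zero mult)
  then show ?thesis by simp
qed

lemma poly_map_pCons: "poly (map_poly f (pCons a p)) t = f a + t * poly (map_poly f p) t"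
  by (simp add: map_poly_pCons zero)

lemma poly_map_mult: "poly (map_poly f (p * q)) t = poly (map_poly f p) t * poly (map_poly f q) t"
  by (induction p) (simp_all add: poly_map_add poly_map_smult poly_map_pCons zero algebra_simps)

lemma comm_ring_map_poly: "comm_ring_map (\<lambda>p. poly (map_poly f p) t)"
  by unfold_locales (simp_all add: poly_map_add poly_map_mult one map_poly_1' )

lemma diff: "f (u - v) = f u - f v"
  using add[of "u - v" v] by simp

lemma power: "f (u ^ n) = f u ^ n"
  by (induction n) (simp_all add: one mult)

end

lemma eval2_comm_ring_map: "comm_ring_map (\<lambda>p. eval2 p x y)"
proof -
  interpret i: comm_ring_map "of_int :: int \<Rightarrow> rat" by unfold_locales auto
  interpret j: comm_ring_map "\<lambda>c. poly (map_poly (of_int :: int \<Rightarrow> rat) c) x" by (rule i.comm_ring_map_poly)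
  show ?thesis unfolding eval2_def by (rule j.comm_ring_map_poly)
qed

locale rational_point = point_of_infinite_order E P for E and P :: "rat point"
begin

text \<open>Beyond n = 4, W obeys the recursion of \<open>psi\<close> by Ward's identity for (k + 1,
  k) and (k + 1, k - 1). The even case is compared after multiplication by psi_2(P) = h_1, which is
  non-zero.\<close>

lemma psi_eq_W: "eval2 (psi E n) (x 1) (y 1) = W n"
proof (induction n rule: less_induct)
  case (less n)
  interpret e: comm_ring_map "\<lambda>p. eval2 p (x 1) (y 1)" by (rule eval2_comm_ring_map)
  have h: "eval2 (psi2 E) (x 1) (y 1) = h 1"
    by (simp add: eval2_def psi2_def h_def wdy_def map_poly_pCons numeral_poly algebra_simps)
  have const: "eval2 [:c:] (x 1) (y 1) = poly (map_poly of_int c) (x 1)" for c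
    by (simp add: eval2_def map_poly_pCons)
  consider "n = 0" | "n = 1" | "n = 2" | "n = 3" | "n = 4" | k where "n = 2 * k + 1" "k \<ge> 2" | k where "n = 2 * k" "k \<ge> 3"
  proof -
    have "n = 0 \<or> n = 1 \<or> n = 2 \<or> n = 3 \<or> n = 4 \<or> (n = 2 * (n div 2) + 1 \<and> n div 2 \<ge> 2) \<or> (n = 2 * (n div 2) \<and> n div 2 \<ge> 3)"
      by presburger
    then show thesis using that by blast
  qed
  then show ?case
  proof cases
    case 1 then show ?thesis using psi_small(1) e.zero by simp
  next
    case 2 then show ?thesis using psi_small(2) e.one by simp
  next
    case 3 then show ?thesis using psi_small(3) h by (simp add: numeral_2_eq_2)
  next
    case 4
    then show ?thesis unfolding 4 psi_small const W_three
      by (simp add: map_poly_pCons algebra_simps power2_eq_square power3_eq_cube power4_eq_xxxx)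
  next
    case 5
    then show ?thesis unfolding 5 psi_small e.mult h const W_four
      by (simp add: map_poly_pCons) Groebner_Basis.algebra
  next
    case (6 k)
    then have "k < n" "k + 1 < n" "k + 2 < n" "k - 1 < n" "k \<ge> 1" by auto
    then have "eval2 (psi E n) (x 1) (y 1) = W (k + 2) * W k ^ 3 - W (k - 1) * W (k + 1) ^ 3"
      using less.IH unfolding 6(1) psi_odd[OF 6(2)] by (simp only: e.diff e.mult e.power)
    moreover have "W n = (W (k + 1))\<^sup>2 * (W k)\<^sup>2 * (x k - x (k + 1))"
      using ward_identity[of k "k + 1"] 6 by (simp add: mult_2)
    moreover have "W (k + 2) * W k = (x 1 - x (k + 1)) * (W (k + 1))\<^sup>2"
      using W_step[of "k + 1"] by (simp del: ward_seq.simps)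
    moreover note W_step[OF \<open>k \<ge> 1\<close>]
    ultimately show ?thesis by Groebner_Basis.algebra
  next
    case (7 k)
    then have lt: "k < n" "k + 1 < n" "k + 2 < n" "k - 1 < n" "k - 2 < n" "k \<ge> 1" by auto
    have "eval2 (psi E n) (x 1) (y 1) * h 1 = eval2 (psi E n * psi2 E) (x 1) (y 1)"
      by (simp only: e.mult h)
    also have "\<dots> = W k * W (k + 2) * (W (k - 1))\<^sup>2 - W k * W (k - 2) * (W (k + 1))\<^sup>2"
      using less.IH lt unfolding 7(1) psi_even_mult[OF 7(2)] by (simp only: e.diff e.mult e.power)
    also have "\<dots> = W n * h 1"
    proof -
      have "W n * h 1 = (W (k + 1))\<^sup>2 * (W (k - 1))\<^sup>2 * (x (k - 1) - x (k + 1))"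
        using ward_identity[of "k - 1" "k + 1"] 7 by (simp add: mult_2 numeral_2_eq_2)
      moreover have "W (k + 2) * W k = (x 1 - x (k + 1)) * (W (k + 1))\<^sup>2"
        using W_step[of "k + 1"] by (simp del: ward_seq.simps)
      moreover have "W k * W (k - 2) = (x 1 - x (k - 1)) * (W (k - 1))\<^sup>2"
        using W_step[of "k - 1"] 7 by (simp del: ward_seq.simps add: numeral_2_eq_2)
      ultimately show ?thesis by Groebner_Basis.algebra
    qed
    finally show ?thesis using h_one_nonzero by simp
  qed
qed

end

subsection \<open>Reduction modulo a prime in terms of the \<open>x\<close>-coordinate\<close>

text \<open>
  With \<open>(N D' - N' D)\<^sup>2\<close>, these are the coefficients of \<open>D\<^sup>2 D'\<^sup>2 G(N/D, N'/D', t)\<close>. On the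
  diagonal they become \<open>\<psi>\<^sub>2\<^sup>2\<close> and \<open>\<psi>\<^sub>2\<^sup>2 x(2Q)\<close>, whose common zeros are the singular points.
\<close>

definition form1 :: "weierstrass \<Rightarrow> int \<Rightarrow> int \<Rightarrow> int \<Rightarrow> int \<Rightarrow> int" where
  "form1 E N D N' D' = (N * D' + N' * D) * (b\<^sub>4 E * D * D' + 2 * N * N') + b\<^sub>2 E * N * N' * D * D' + b\<^sub>6 E * D\<^sup>2 * D'\<^sup>2"

definition form2 :: "weierstrass \<Rightarrow> int \<Rightarrow> int \<Rightarrow> int \<Rightarrow> int \<Rightarrow> int" where
  "form2 E N D N' D' = N\<^sup>2 * N'\<^sup>2 - b\<^sub>4 E * N * N' * D * D' - b\<^sub>6 E * (N * D' + N' * D) * D * D' - b\<^sub>8 E * D\<^sup>2 * D'\<^sup>2"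

definition singular_mod :: "weierstrass \<Rightarrow> int \<Rightarrow> int \<Rightarrow> int \<Rightarrow> bool" where
  "singular_mod E p N D \<longleftrightarrow> p dvd form1 E N D N D \<and> p dvd form2 E N D N D"

lemma form_swap: "form1 E N D N' D' = form1 E N' D' N D" "form2 E N D N' D' = form2 E N' D' N D"
  by (simp_all add: form1_def form2_def algebra_simps)

text \<open>(N', D') is non-zero modulo p, and \<open>d\<close> makes (N, D) a multiple of it modulo
  p. A homogeneous form vanishing at (N', D') vanishes at all its multiples.\<close>

lemma binary_form_dvd:
  fixes p :: int
  assumes p: "Factorial_Ring.prime p" and c: "coprime N' D'"
    and d: "p dvd N * D' - N' * D" and f: "p dvd \<alpha> * N'\<^sup>2 + \<beta> * N' * D' + \<gamma> * D'\<^sup>2"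
  shows "p dvd \<alpha> * N\<^sup>2 + \<beta> * N * D + \<gamma> * D\<^sup>2" (is "p dvd ?f")
proof -
  have "D'\<^sup>2 * ?f = D\<^sup>2 * (\<alpha> * N'\<^sup>2 + \<beta> * N' * D' + \<gamma> * D'\<^sup>2) + (N * D' - N' * D) * (\<alpha> * (D * N' + D' * N) + \<beta> * D * D')"
    by Groebner_Basis.algebra
  then have 1: "p dvd D'\<^sup>2 * ?f" using d f by simp
  have "N'\<^sup>2 * ?f = N\<^sup>2 * (\<alpha> * N'\<^sup>2 + \<beta> * N' * D' + \<gamma> * D'\<^sup>2) - (N * D' - N' * D) * (\<beta> * N * N' + \<gamma> * (N * D' + N' * D))"
    by Groebner_Basis.algebra
  then have 2: "p dvd N'\<^sup>2 * ?f" using d f by simp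
  show ?thesis
  proof (rule ccontr)
    assume "\<not> ?thesis"
    then have "p dvd D'" "p dvd N'"
      using 1 2 p by (meson prime_dvd_mult_iff prime_dvd_power)+
    then show False using c p by (meson coprime_common_divisor not_prime_unit)
  qed
qed

text \<open>For fixed (N, D) both forms are binary quadratic in (N', D'), so the latter may be
  replaced by (N, D) itself.\<close>

lemma singular_mod_if_forms_dvd:
  fixes p :: int
  assumes "Factorial_Ring.prime p" "coprime N' D'" "p dvd (N * D' - N' * D)\<^sup>2"
    "p dvd form1 E N D N' D'" "p dvd form2 E N D N' D'"
  shows "singular_mod E p N D"
proof -
  have d: "p dvd N * D' - N' * D" using assms prime_dvd_power by blast
  have 1: "form1 E N D K L = (2 * N * D) * K\<^sup>2 + (b\<^sub>4 E * D\<^sup>2 + 2 * N\<^sup>2 + b\<^sub>2 E * N * D) * K * L + (b\<^sub>4 E * N * D + b\<^sub>6 E * D\<^sup>2) * L\<^sup>2" for K L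
    unfolding form1_def by Groebner_Basis.algebra
  have 2: "form2 E N D K L = N\<^sup>2 * K\<^sup>2 + (- b\<^sub>4 E * N * D - b\<^sub>6 E * D\<^sup>2) * K * L + (- b\<^sub>6 E * N * D - b\<^sub>8 E * D\<^sup>2) * L\<^sup>2" for K L
    unfolding form2_def by Groebner_Basis.algebra
  show ?thesis
    using binary_form_dvd[OF assms(1,2) d] assms(4,5) unfolding singular_mod_def 1 2 by blast
qed

text \<open>Gauss' lemma: (D3 t - N3)(D4 t - N4) is primitive as a product of primitive polynomials,
  so the proportional integral polynomial F0 t^2 - F1 t + F2 is an integral multiple of it.\<close>

lemma primitive_quadratic_dvd:
  fixes N3 D3 N4 D4 F0 F1 F2 :: int
  assumes c: "coprime N3 D3" "coprime N4 D4" and nz: "D3 * D4 \<noteq> 0"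
    and 1: "F1 * (D3 * D4) = F0 * (N3 * D4 + N4 * D3)" and 2: "F2 * (D3 * D4) = F0 * (N3 * N4)"
  obtains g where "F0 = g * (D3 * D4)" "F1 = g * (N3 * D4 + N4 * D3)" "F2 = g * (N3 * N4)"
proof -
  have "coprime (D3 * D4) (gcd (N3 * D4 + N4 * D3) (N3 * N4))"
  proof (rule ccontr)
    assume "\<not> ?thesis"
    then have "\<not> is_unit (gcd (D3 * D4) (gcd (N3 * D4 + N4 * D3) (N3 * N4)))"
      by (metis is_unit_gcd)
    then obtain q where "Factorial_Ring.prime q" "q dvd gcd (D3 * D4) (gcd (N3 * D4 + N4 * D3) (N3 * N4))"
      using prime_divisor_exists[of "gcd (D3 * D4) (gcd (N3 * D4 + N4 * D3) (N3 * N4))"] nz by auto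
    then obtain p where p: "Factorial_Ring.prime p" "p dvd D3 * D4" "p dvd N3 * D4 + N4 * D3" "p dvd N3 * N4"
      by (meson gcd_greatest_iff)
    have np: "\<not> (p dvd N3 \<and> p dvd D3)" "\<not> (p dvd N4 \<and> p dvd D4)"
      using c p(1) by (meson coprime_common_divisor not_prime_unit)+
    show False
    proof (cases "p dvd D3")
      case True
      then have "p dvd N3 * D4" using p(3) by (simp add: dvd_add_left_iff)
      then show ?thesis using True np p by (auto simp: prime_dvd_mult_iff)
    next
      case False
      then have z: "p dvd D4" using p by (simp add: prime_dvd_mult_iff)
      then have "p dvd N4 * D3" using p(3) by (simp add: dvd_add_right_iff)
      then show ?thesis using z False np p by (auto simp: prime_dvd_mult_iff)
    qed
  qed
  moreover have "D3 * D4 dvd F0 * gcd (N3 * D4 + N4 * D3) (N3 * N4)"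
  proof -
    have "D3 * D4 dvd gcd (F0 * (N3 * D4 + N4 * D3)) (F0 * (N3 * N4))"
      unfolding 1[symmetric] 2[symmetric] by simp
    then show ?thesis by (cases "F0 \<ge> 0") (simp_all add: gcd_mult_distrib_int[symmetric])
  qed
  ultimately have "D3 * D4 dvd F0" by (simp add: coprime_dvd_mult_left_iff)
  then obtain g where g: "F0 = g * (D3 * D4)" by (metis dvdE mult.commute)
  show thesis
    by (rule that[OF g]) (use 1 2 nz in \<open>simp_all add: g mult.assoc mult.left_commute\<close>)
qed

lemma form_at_one:
  "form1 E t 1 t 1 = 4 * t ^ 3 + b\<^sub>2 E * t\<^sup>2 + 2 * b\<^sub>4 E * t + b\<^sub>6 E"
  "form2 E t 1 t 1 = t ^ 4 - b\<^sub>4 E * t\<^sup>2 - 2 * b\<^sub>6 E * t - b\<^sub>8 E"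
  by (simp_all add: form1_def form2_def algebra_simps power2_eq_square power3_eq_cube power4_eq_xxxx)

text \<open>On the diagonal both forms are homogeneous of degree 4 in (N, D).\<close>

lemma singular_mod_scale:
  assumes "[N = s * D] (mod p)"
  shows "[form1 E N D N D = D ^ 4 * form1 E s 1 s 1] (mod p)" "[form2 E N D N D = D ^ 4 * form2 E s 1 s 1] (mod p)"
proof -
  have "[form1 E N D N D = form1 E (s * D) D (s * D) D] (mod p)" "[form2 E N D N D = form2 E (s * D) D (s * D) D] (mod p)"
    unfolding form1_def form2_def by (intro cong_add cong_diff cong_mult cong_pow cong_refl assms)+
  moreover have "form1 E (s * D) D (s * D) D = D ^ 4 * form1 E s 1 s 1" "form2 E (s * D) D (s * D) D = D ^ 4 * form2 E s 1 s 1"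
    unfolding form_at_one unfolding form1_def form2_def by Groebner_Basis.algebra+
  ultimately show "[form1 E N D N D = D ^ 4 * form1 E s 1 s 1] (mod p)" "[form2 E N D N D = D ^ 4 * form2 E s 1 s 1] (mod p)" by simp_all
qed

lemma b8_relation: "4 * b\<^sub>8 E = b\<^sub>2 E * b\<^sub>6 E - (b\<^sub>4 E)\<^sup>2"
  unfolding b\<^sub>2_def b\<^sub>4_def b\<^sub>6_def b\<^sub>8_def by Groebner_Basis.algebra

text \<open>The point at infinity is never singular: if p divides D, then \<open>form2\<close>
  reduces to N^4.\<close>

lemma not_dvd_D_if_singular_mod:
  fixes p :: int
  assumes "Factorial_Ring.prime p" "coprime N D" "singular_mod E p N D"
  shows "\<not> p dvd D"
proof
  assume z: "p dvd D"
  have "form2 E N D N D = N ^ 4 - D * (b\<^sub>4 E * N * N * D + b\<^sub>6 E * (N * D + N * D) * D + b\<^sub>8 E * D * D\<^sup>2)"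
    unfolding form2_def by Groebner_Basis.algebra
  then have "N ^ 4 = form2 E N D N D + D * (b\<^sub>4 E * N * N * D + b\<^sub>6 E * (N * D + N * D) * D + b\<^sub>8 E * D * D\<^sup>2)"
    by simp
  then have "p dvd N ^ 4" using z assms(3) by (simp add: singular_mod_def)
  then have "p dvd N" using assms(1) prime_dvd_power by blast
  then show False using z assms(1,2) by (meson coprime_common_divisor not_prime_unit)
qed

text \<open>
  If \<open>t\<close> is the \<open>x\<close>-coordinate of the singular point, then modulo \<open>p\<close> the polynomial
  \<open>G(t, x(R), s)\<close> is a multiple of \<open>(s - t)\<^sup>2\<close>: a singular point plus or minus a non-singular
  one is again singular.
\<close>

lemma singular_mod_step:
  fixes p :: int
  assumes p: "Factorial_Ring.prime p" and c: "coprime N D" "coprime N' D'" "coprime N3 D3" "coprime N4 D4"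
    and s: "singular_mod E p N D" and ns: "\<not> singular_mod E p N' D'"
    and F0: "(N * D' - N' * D)\<^sup>2 = g * (D3 * D4)"
    and F1: "form1 E N D N' D' = g * (N3 * D4 + N4 * D3)"
    and F2: "form2 E N D N' D' = g * (N3 * N4)"
  shows "singular_mod E p N4 D4"
proof -
  \<comment> \<open>If p divided g, it would divide all three coefficients, and
    \<open>singular_mod_if_forms_dvd\<close> with the two points exchanged would make the second one
    singular.\<close>
  have pg: "\<not> p dvd g"
  proof
    assume "p dvd g"
    then have "singular_mod E p N' D'"
      using F0 F1 F2 form_swap[of E N D N' D'] p c(1)
      by (intro singular_mod_if_forms_dvd[of p N D]) (auto simp: power2_commute[of "N' * D"])
    then show False using ns by simp
  qed
  have "coprime D p"
    using not_dvd_D_if_singular_mod[OF p c(1) s] prime_imp_coprime[OF p, of D] coprime_commute by blast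
  then obtain z where z: "[D * z = 1] (mod p)" using cong_solve_coprime_int by blast
  define t where "t = N * z"
  have X: "[N = t * D] (mod p)"
    using cong_scalar_left[OF z, of N] by (simp add: t_def cong_sym_eq ac_simps)
  have "coprime p (D ^ 4)" using \<open>coprime D p\<close> by (simp add: coprime_commute)
  then have t: "p dvd form1 E t 1 t 1" "p dvd form2 E t 1 t 1"
    using s cong_dvd_iff[OF singular_mod_scale(1)[OF X, of E]] cong_dvd_iff[OF singular_mod_scale(2)[OF X, of E]]
    unfolding singular_mod_def
    by (simp_all add: coprime_dvd_mult_right_iff)
  \<comment> \<open>This is half the derivative of the cubic \<open>form1 E t 1 t 1\<close>. To
    include p = 2 it is reached through its square, a combination of the two forms.\<close>
  have t4: "p dvd 6 * t\<^sup>2 + b\<^sub>2 E * t + b\<^sub>4 E"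
  proof -
    have "(6 * t\<^sup>2 + b\<^sub>2 E * t + b\<^sub>4 E)\<^sup>2 = (b\<^sub>2 E + 12 * t) * form1 E t 1 t 1 - 4 * (t * form1 E t 1 t 1 - form2 E t 1 t 1)"
      using b8_relation[of E] unfolding form_at_one by Groebner_Basis.algebra
    then have "p dvd (6 * t\<^sup>2 + b\<^sub>2 E * t + b\<^sub>4 E)\<^sup>2" using t by simp
    then show ?thesis using p prime_dvd_power by blast
  qed
  have a: "[(N * D' - N' * D)\<^sup>2 = (t * D * D' - N' * D)\<^sup>2] (mod p)"
     "[form1 E N D N' D' = form1 E (t * D) D N' D'] (mod p)" "[form2 E N D N' D' = form2 E (t * D) D N' D'] (mod p)"
    unfolding form1_def form2_def by (intro cong_add cong_diff cong_mult cong_pow cong_refl X)+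
  \<comment> \<open>The value at s = t of the quadratic F0 s^2 - F1 s + F2.\<close>
  have "p dvd (N * D' - N' * D)\<^sup>2 * t\<^sup>2 - form1 E N D N' D' * t + form2 E N D N' D'"
  proof -
    have "(t * D * D' - N' * D)\<^sup>2 * t\<^sup>2 - form1 E (t * D) D N' D' * t + form2 E (t * D) D N' D' =
       - (D\<^sup>2) * (form1 E t 1 t 1 * (N' - t * D') * D' + (t * form1 E t 1 t 1 - form2 E t 1 t 1) * D'\<^sup>2)"
      unfolding form_at_one unfolding form1_def form2_def by Groebner_Basis.algebra
    then have "p dvd (t * D * D' - N' * D)\<^sup>2 * t\<^sup>2 - form1 E (t * D) D N' D' * t + form2 E (t * D) D N' D'"
      using t by simp
    then show ?thesis
      using cong_dvd_iff[OF cong_add[OF cong_diff[OF cong_mult[OF a(1) cong_refl] cong_mult[OF a(2) cong_refl]] a(3)]] by blast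
  qed
  moreover have "(N * D' - N' * D)\<^sup>2 * t\<^sup>2 - form1 E N D N' D' * t + form2 E N D N' D' = g * ((N3 - t * D3) * (N4 - t * D4))"
    unfolding F0 F1 F2 by Groebner_Basis.algebra
  ultimately have val: "p dvd N3 - t * D3 \<or> p dvd N4 - t * D4"
    using p pg by (simp add: prime_dvd_mult_iff)
  \<comment> \<open>The derivative at s = t of the same quadratic: t is a double root modulo
    p.\<close>
  have "p dvd 2 * (N * D' - N' * D)\<^sup>2 * t - form1 E N D N' D'"
  proof -
    have "2 * (t * D * D' - N' * D)\<^sup>2 * t - form1 E (t * D) D N' D' =
       - (D\<^sup>2) * ((6 * t\<^sup>2 + b\<^sub>2 E * t + b\<^sub>4 E) * (N' - t * D') * D' + form1 E t 1 t 1 * D'\<^sup>2)"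
      unfolding form_at_one unfolding form1_def by Groebner_Basis.algebra
    then have "p dvd 2 * (t * D * D' - N' * D)\<^sup>2 * t - form1 E (t * D) D N' D'"
      using t t4 by simp
    then show ?thesis
      using cong_dvd_iff[OF cong_diff[OF cong_mult[OF cong_mult[OF cong_refl a(1)] cong_refl] a(2)]] by blast
  qed
  moreover have "2 * (N * D' - N' * D)\<^sup>2 * t - form1 E N D N' D' = - g * (D3 * (N4 - t * D4) + D4 * (N3 - t * D3))"
    unfolding F0 F1 by Groebner_Basis.algebra
  ultimately have der: "p dvd D3 * (N4 - t * D4) + D4 * (N3 - t * D3)"
    using p pg by (simp add: prime_dvd_mult_iff)
  \<comment> \<open>By \<open>val\<close>, t is a root of one linear factor. Were it only the one of
    index 3, the derivative would force p to divide D3 and then N3.\<close>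
  have "p dvd N4 - t * D4"
  proof (rule ccontr)
    assume n4: "\<not> ?thesis"
    then have 3: "p dvd N3 - t * D3" using val by blast
    then have "p dvd D3 * (N4 - t * D4)" using der by (simp add: dvd_add_left_iff)
    then have z3: "p dvd D3" using n4 p by (simp add: prime_dvd_mult_iff)
    then have "p dvd N3" using 3 by (metis dvd_diff_commute dvd_mult dvd_diff_right_iff)
    then show False using z3 c(3) p by (meson coprime_common_divisor not_prime_unit)
  qed
  then have "[N4 = t * D4] (mod p)" by (simp add: cong_iff_dvd_diff)
  then show ?thesis
    using singular_mod_scale[of N4 t D4 p E] t unfolding singular_mod_def by (meson cong_dvd_iff dvd_mult)
qed

subsection \<open>Denominators of the multiples\<close>

text \<open>With x = a/c and y = e/f in lowest terms, clearing denominators gives f^2 N on one side,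
  with N prime to c. Then c^2 divides f^2, so f = c g; next c divides g^2 and g^2 divides c. Hence c
  = g^2 and f = g^3.\<close>

lemma weq_denominators:
  fixes x y :: rat
  assumes "weq E x y"
  obtains A B C where "B > 0" "coprime A B" "x = of_int A / (of_int B)\<^sup>2" "y = of_int C / of_int B ^ 3"
proof -
  obtain a c where x: "x = Rat.Fract a c" "c > 0" "coprime a c" by (cases x)
  obtain e f where y: "y = Rat.Fract e f" "f > 0" "coprime e f" by (cases y)
  define N where "N = a ^ 3 + a\<^sub>2 E * a\<^sup>2 * c + a\<^sub>4 E * a * c\<^sup>2 + a\<^sub>6 E * c ^ 3"
  have xq: "x * of_int c = of_int a" "y * of_int f = of_int e" using x y by (simp_all add: Fract_of_int_quotient)
  have "(of_int (c ^ 3 * e\<^sup>2 + a\<^sub>1 E * a * c\<^sup>2 * e * f + a\<^sub>3 E * c ^ 3 * e * f) :: rat) = of_int (f\<^sup>2 * N)"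
    using assms unfolding N_def weq_def of_int_mult of_int_add of_int_power xq[symmetric] by Groebner_Basis.algebra
  then have eq: "c ^ 3 * e\<^sup>2 + a\<^sub>1 E * a * c\<^sup>2 * e * f + a\<^sub>3 E * c ^ 3 * e * f = f\<^sup>2 * N"
    by (simp only: of_int_eq_iff)
  have N: "coprime N c"
  proof -
    have "N = (a\<^sub>2 E * a\<^sup>2 + a\<^sub>4 E * a * c + a\<^sub>6 E * c\<^sup>2) * c + a ^ 3"
      unfolding N_def by Groebner_Basis.algebra
    moreover have "coprime c (a ^ 3)" using x by (simp add: coprime_commute)
    ultimately have "gcd c N = 1" by (simp only: gcd_add_mult coprime_iff_gcd_eq_1)
    then show ?thesis by (simp add: coprime_iff_gcd_eq_1 gcd.commute)
  qed
  have "c\<^sup>2 * (c * e\<^sup>2 + a\<^sub>1 E * a * e * f + a\<^sub>3 E * c * e * f) = f\<^sup>2 * N"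
    unfolding eq[symmetric] by Groebner_Basis.algebra
  then have "c\<^sup>2 dvd f\<^sup>2 * N" by (metis dvd_triv_left)
  moreover have "coprime (c\<^sup>2) N" using N by (simp add: coprime_commute)
  ultimately have "c\<^sup>2 dvd f\<^sup>2" by (simp add: coprime_dvd_mult_left_iff)
  then have "c dvd f" by simp
  then obtain g where f: "f = c * g" by blast
  have g: "g > 0" using f x(2) y(2) zero_less_mult_pos by blast
  have "c\<^sup>2 * (c * (e\<^sup>2 + g * (a\<^sub>1 E * a * e + a\<^sub>3 E * c * e))) = c\<^sup>2 * (g\<^sup>2 * N)"
    using eq unfolding f by Groebner_Basis.algebra
  then have eq': "c * (e\<^sup>2 + g * (a\<^sub>1 E * a * e + a\<^sub>3 E * c * e)) = g\<^sup>2 * N" using x(2) by simp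
  have "c dvd g\<^sup>2 * N" unfolding eq'[symmetric] by simp
  then have 1: "c dvd g\<^sup>2" using N by (simp add: coprime_dvd_mult_left_iff coprime_commute)
  have ge: "coprime (g\<^sup>2) (e\<^sup>2 + g * (a\<^sub>1 E * a * e + a\<^sub>3 E * c * e))"
  proof -
    have "coprime g (e\<^sup>2)" using y(3) f by (simp add: coprime_commute)
    then have "coprime g (e\<^sup>2 + g * (a\<^sub>1 E * a * e + a\<^sub>3 E * c * e))"
      using gcd_add_mult[of g "a\<^sub>1 E * a * e + a\<^sub>3 E * c * e" "e\<^sup>2"]
      by (simp only: coprime_iff_gcd_eq_1 add.commute mult.commute)
    then show ?thesis by simp
  qed
  have "g\<^sup>2 dvd c * (e\<^sup>2 + g * (a\<^sub>1 E * a * e + a\<^sub>3 E * c * e))" unfolding eq' by simp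
  then have "g\<^sup>2 dvd c" using ge by (simp add: coprime_dvd_mult_left_iff)
  then have c: "c = g\<^sup>2" using 1 x(2) by (simp add: zdvd_antisym_nonneg)
  show thesis
  proof
    show "g > 0" by (rule g)
    show "coprime a g" using x(3) c by simp
    show "x = of_int a / (of_int g)\<^sup>2" using x(1) c by (simp add: Fract_of_int_quotient)
    show "y = of_int e / of_int g ^ 3" using y(1) f c by (simp add: Fract_of_int_quotient power2_eq_square power3_eq_cube)
  qed
qed

lemma denom_root_eq:
  assumes "B > 0" "coprime A B" "x = of_int A / (of_int B)\<^sup>2"
  shows "denom_root (Affine x y) = B"
  unfolding denom_root.simps
proof (rule the_equality)
  fix B' :: int assume "B' > 0 \<and> (\<exists>A. coprime A B' \<and> x = of_int A / (of_int B')\<^sup>2)"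
  then obtain A' where B': "B' > 0" "coprime A' B'" "x = of_int A' / (of_int B')\<^sup>2" by blast
  have "(of_int (A * B'\<^sup>2) :: rat) = of_int (A' * B\<^sup>2)"
    using assms(1,3) B'(1,3) by (simp add: field_simps)
  then have eq: "A * B'\<^sup>2 = A' * B\<^sup>2" by (simp only: of_int_eq_iff)
  have "B'\<^sup>2 dvd A' * B\<^sup>2" "B\<^sup>2 dvd A * B'\<^sup>2" using eq by (metis dvd_triv_right)+
  then have "B'\<^sup>2 dvd B\<^sup>2" "B\<^sup>2 dvd B'\<^sup>2"
    using assms(2) B'(2) by (simp_all add: coprime_dvd_mult_right_iff coprime_commute)
  then show "B' = B" using assms(1) B'(1) by (simp add: zdvd_antisym_nonneg)
qed (use assms in auto)

context rational_point
begin

definition "den n = denom_root (wmult E P n)"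
text \<open>The floor only changes the type: for n \<ge> 1 its argument is an integer.\<close>

definition "num n = \<lfloor>x n * (of_int (den n))\<^sup>2\<rfloor>"

lemma den_num:
  assumes "n \<ge> 1"
  shows "den n > 0" "coprime (num n) (den n)" "x n = of_int (num n) / (of_int (den n))\<^sup>2"
    "\<exists>C. y n = of_int C / of_int (den n) ^ 3"
proof -
  obtain A B C where 1: "B > 0" "coprime A B" "x n = of_int A / (of_int B)\<^sup>2" "y n = of_int C / of_int B ^ 3"
    using weq_denominators[OF weq_mult[OF assms]] .
  have "den n = B" using denom_root_eq[OF 1(1-3)] wmult_eq[OF assms] by (simp add: den_def)
  moreover from this have "num n = A" using 1 by (simp add: num_def)
  ultimately show "den n > 0" "coprime (num n) (den n)" "x n = of_int (num n) / (of_int (den n))\<^sup>2"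
    "\<exists>C. y n = of_int C / of_int (den n) ^ 3" using 1 by auto
qed

definition "singular_at p n \<longleftrightarrow> singular_mod E p (num n) ((den n)\<^sup>2)"

lemma coprime_num: "n \<ge> 1 \<Longrightarrow> coprime (num n) ((den n)\<^sup>2)"
  using den_num(2) by simp

lemma x_inj:
  assumes "m \<ge> 1" "m < n"
  shows "x m \<noteq> x n"
  using ward_identity[of m n] W_nonzero[of "n + m"] W_nonzero[of "n - m"] assms by auto

text \<open>\<open>G_multiples\<close> with denominators cleared, followed by Gauss' lemma. The
  factor g measures the cancellation.\<close>

lemma forms_eq:
  assumes "m \<ge> 1" "m < n"
  obtains g where
    "(num n * (den m)\<^sup>2 - num m * (den n)\<^sup>2)\<^sup>2 = g * ((den (n + m))\<^sup>2 * (den (n - m))\<^sup>2)"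
    "form1 E (num n) ((den n)\<^sup>2) (num m) ((den m)\<^sup>2) =
       g * (num (n + m) * (den (n - m))\<^sup>2 + num (n - m) * (den (n + m))\<^sup>2)"
    "form2 E (num n) ((den n)\<^sup>2) (num m) ((den m)\<^sup>2) = g * (num (n + m) * num (n - m))"
proof -
  let ?r = "of_int :: int \<Rightarrow> rat"
  have ge: "n \<ge> 1" "n + m \<ge> 1" "n - m \<ge> 1" using assms by auto
  define Zn Zm Z3 Z4 where Z: "Zn = (den n)\<^sup>2" "Zm = (den m)\<^sup>2" "Z3 = (den (n + m))\<^sup>2" "Z4 = (den (n - m))\<^sup>2"
  have nz: "?r Zn \<noteq> 0" "?r Zm \<noteq> 0" "?r Z3 \<noteq> 0" "?r Z4 \<noteq> 0"
    using den_num(1) ge assms(1) by (auto simp: Z less_imp_neq[symmetric])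
  have x: "?r (num n) = x n * ?r Zn" "?r (num m) = x m * ?r Zm"
    "?r (num (n + m)) = x (n + m) * ?r Z3" "?r (num (n - m)) = x (n - m) * ?r Z4"
    using den_num(3) ge assms(1) nz by (auto simp: Z)
  \<comment> \<open>The coefficients in t are extracted from the values at t = 0 and t = 1.\<close>
  have prod: "x (n + m) * x (n - m) * (x n - x m)\<^sup>2 =
       (x n)\<^sup>2 * (x m)\<^sup>2 - ?r (b\<^sub>4 E) * x n * x m - ?r (b\<^sub>6 E) * (x n + x m) - ?r (b\<^sub>8 E)"
    using G_multiples[OF assms, of 0] by (simp add: quad_form_def)
  have sum: "(x (n + m) + x (n - m)) * (x n - x m)\<^sup>2 =
       (x n + x m) * (?r (b\<^sub>4 E) + 2 * x n * x m) + ?r (b\<^sub>2 E) * x n * x m + ?r (b\<^sub>6 E)"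
  proof -
    have "(x n - x m)\<^sup>2 - ((x n + x m) * (?r (b\<^sub>4 E) + 2 * x n * x m) + ?r (b\<^sub>2 E) * x n * x m + ?r (b\<^sub>6 E))
       + x (n + m) * x (n - m) * (x n - x m)\<^sup>2 = (x n - x m)\<^sup>2 * ((x (n + m) - 1) * (x (n - m) - 1))"
      using G_multiples[OF assms, of 1] unfolding prod by (simp add: quad_form_def)
    then show ?thesis by Groebner_Basis.algebra
  qed
  have 1: "form1 E (num n) Zn (num m) Zm * (Z3 * Z4)
      = (num n * Zm - num m * Zn)\<^sup>2 * (num (n + m) * Z4 + num (n - m) * Z3)"
  proof -
    have "?r (form1 E (num n) Zn (num m) Zm * (Z3 * Z4))
      = ?r ((num n * Zm - num m * Zn)\<^sup>2 * (num (n + m) * Z4 + num (n - m) * Z3))"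
      unfolding form1_def of_int_mult of_int_add of_int_diff of_int_power of_int_numeral x
      using sum by Groebner_Basis.algebra
    then show ?thesis by (simp only: of_int_eq_iff)
  qed
  have 2: "form2 E (num n) Zn (num m) Zm * (Z3 * Z4)
      = (num n * Zm - num m * Zn)\<^sup>2 * (num (n + m) * num (n - m))"
  proof -
    have "?r (form2 E (num n) Zn (num m) Zm * (Z3 * Z4))
      = ?r ((num n * Zm - num m * Zn)\<^sup>2 * (num (n + m) * num (n - m)))"
      unfolding form2_def of_int_mult of_int_add of_int_diff of_int_power of_int_numeral x
      using prod by Groebner_Basis.algebra
    then show ?thesis by (simp only: of_int_eq_iff)
  qed
  have "coprime (num (n + m)) Z3" "coprime (num (n - m)) Z4" "Z3 * Z4 \<noteq> 0"
    using coprime_num ge nz by (auto simp: Z)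
  from primitive_quadratic_dvd[OF this 1 2] show thesis using that unfolding Z .
qed

lemma singular_at_diff:
  assumes "m \<ge> 1" "m < n" "Factorial_Ring.prime p" "singular_at p n" "\<not> singular_at p m"
  shows "singular_at p (n - m)"
proof -
  have ge: "n \<ge> 1" "n + m \<ge> 1" "n - m \<ge> 1" using assms by auto
  obtain g where g:
    "(num n * (den m)\<^sup>2 - num m * (den n)\<^sup>2)\<^sup>2 = g * ((den (n + m))\<^sup>2 * (den (n - m))\<^sup>2)"
    "form1 E (num n) ((den n)\<^sup>2) (num m) ((den m)\<^sup>2) =
       g * (num (n + m) * (den (n - m))\<^sup>2 + num (n - m) * (den (n + m))\<^sup>2)"
    "form2 E (num n) ((den n)\<^sup>2) (num m) ((den m)\<^sup>2) = g * (num (n + m) * num (n - m))"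
    using forms_eq[OF assms(1,2)] .
  show ?thesis
    unfolding singular_at_def
    by (rule singular_mod_step[OF assms(3) coprime_num[OF ge(1)] coprime_num[OF assms(1)]
          coprime_num[OF ge(2)] coprime_num[OF ge(3)] assms(4)[unfolded singular_at_def]
          assms(5)[unfolded singular_at_def] g])
qed

text \<open>Descent: if (k + 1)r were singular, subtracting the non-singular r would leave kr
  singular. This takes the place of the closure of \<open>E0\<close> under addition.\<close>

lemma not_singular_at_multiple:
  assumes "Factorial_Ring.prime p" "\<not> singular_at p r" "r \<ge> 1" "k \<ge> 1"
  shows "\<not> singular_at p (k * r)"
  using assms(4)
proof (induction k rule: dec_induct)
  case (step k)
  have "r < Suc k * r" "Suc k * r - r = k * r" using step(1) assms(3) by auto
  then show ?case using singular_at_diff[of r "Suc k * r" p] assms(1-3) step.IH by metis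
qed (use assms in simp)

text \<open>A prime factor of g would make both nP and mP singular, so g is a unit; it is positive
  because D^2 is. With g = 1 the first equation of \<open>forms_eq\<close> equates two
  squares.\<close>

lemma den_mult_den:
  assumes mn: "m \<ge> 1" "m < n" and ns: "\<And>p. Factorial_Ring.prime p \<Longrightarrow> \<not> (singular_at p n \<and> singular_at p m)"
  shows "of_int (den (n + m) * den (n - m)) = \<bar>x m - x n\<bar> * (of_int (den n))\<^sup>2 * (of_int (den m))\<^sup>2"
proof -
  have ge: "n \<ge> 1" "n + m \<ge> 1" "n - m \<ge> 1" using mn by auto
  define D where "D = num n * (den m)\<^sup>2 - num m * (den n)\<^sup>2"
  obtain g where g: "D\<^sup>2 = g * ((den (n + m))\<^sup>2 * (den (n - m))\<^sup>2)"
    "form1 E (num n) ((den n)\<^sup>2) (num m) ((den m)\<^sup>2) =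
       g * (num (n + m) * (den (n - m))\<^sup>2 + num (n - m) * (den (n + m))\<^sup>2)"
    "form2 E (num n) ((den n)\<^sup>2) (num m) ((den m)\<^sup>2) = g * (num (n + m) * num (n - m))"
    using forms_eq[OF mn] unfolding D_def .
  have pos: "den n > 0" "den m > 0" "den (n + m) > 0" "den (n - m) > 0" using den_num(1) ge mn by auto
  have D: "of_int D = (x n - x m) * (of_int (den n))\<^sup>2 * (of_int (den m))\<^sup>2"
    using den_num(3)[OF ge(1)] den_num(3)[OF mn(1)] pos by (simp add: D_def field_simps)
  then have "D \<noteq> 0" using x_inj[OF mn] pos by auto
  have "is_unit g"
  proof (rule ccontr)
    assume "\<not> ?thesis"
    moreover have "g \<noteq> 0" using \<open>D \<noteq> 0\<close> g(1) by auto
    ultimately obtain p where p: "Factorial_Ring.prime p" "p dvd g" using prime_divisor_exists by blast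
    have "singular_at p n" unfolding singular_at_def
      using g p coprime_num[OF mn(1)] unfolding D_def by (intro singular_mod_if_forms_dvd[of p "num m" "(den m)\<^sup>2"]) auto
    moreover have "singular_at p m" unfolding singular_at_def
      using g p coprime_num[OF ge(1)] form_swap[of E "num n" "(den n)\<^sup>2" "num m" "(den m)\<^sup>2"]
      unfolding D_def by (intro singular_mod_if_forms_dvd[of p "num n" "(den n)\<^sup>2"]) (auto simp: power2_commute[of "num m * _"])
    ultimately show False using ns[OF p(1)] by blast
  qed
  moreover have "g > 0"
  proof -
    have "g * ((den (n + m))\<^sup>2 * (den (n - m))\<^sup>2) > 0" using \<open>D \<noteq> 0\<close> unfolding g(1)[symmetric] by simp
    moreover have "(den (n + m))\<^sup>2 * (den (n - m))\<^sup>2 > 0" using pos by simp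
    ultimately show ?thesis using zero_less_mult_pos2 by blast
  qed
  ultimately have "g = 1" by simp
  then have "\<bar>D\<bar>\<^sup>2 = (den (n + m) * den (n - m))\<^sup>2" using g(1) by (simp add: power_mult_distrib)
  then have "\<bar>D\<bar> = den (n + m) * den (n - m)" using pos by (simp add: abs_eq_iff' power2_eq_iff)
  then have "of_int (den (n + m) * den (n - m)) = \<bar>of_int D :: rat\<bar>" by (metis of_int_abs)
  then show ?thesis unfolding D by (simp add: abs_mult abs_minus_commute)
qed

end

subsection \<open>The field \<open>\<rat>\<^sub>p\<close>\<close>

locale padic =
  fixes p :: nat
  assumes prime_p: "Factorial_Ring.prime p"
begin

section \<open>The p-adic absolute value\<close>

abbreviation v :: "int \<Rightarrow> nat" where "v \<equiv> multiplicity (int p)"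
abbreviation pabs :: "rat \<Rightarrow> real" where "pabs \<equiv> padic_abs p"

lemma prime_int: "Factorial_Ring.prime (int p)"
  using prime_p by simp

lemma p_gt_1: "real p > 1"
  using prime_gt_1_nat[OF prime_p] by simp

lemma v_mult: "a \<noteq> 0 \<Longrightarrow> b \<noteq> 0 \<Longrightarrow> v (a * b) = v a + v b"
  using prime_int by (simp add: prime_elem_multiplicity_mult_distrib)

lemma pabs_zero: "pabs 0 = 0"
  by (simp add: padic_abs_def)

text \<open>Cancelling a common factor lowers both valuations equally, so any fraction may replace
  the reduced one from \<open>quotient_of\<close>.\<close>

lemma pabs_fraction:
  assumes "a \<noteq> 0" "b \<noteq> 0"
  shows "pabs (of_int a / of_int b) = real p powi (int (v b) - int (v a))"
proof -
  obtain c d where q: "quotient_of (of_int a / of_int b) = (c, d)" by fastforce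
  have d: "d > 0" and eq: "(of_int a / of_int b :: rat) = of_int c / of_int d"
    using quotient_of_denom_pos[OF q] quotient_of_div[OF q] by auto
  have c: "c \<noteq> 0" using eq assms by auto
  have "(of_int (a * d) :: rat) = of_int (c * b)"
    using eq d assms by (simp add: field_simps)
  then have "a * d = c * b" by (simp only: of_int_eq_iff)
  then have "v a + v d = v c + v b" using v_mult assms c d by (metis less_irrefl)
  then have "int (v d) - int (v c) = int (v b) - int (v a)" by linarith
  then show ?thesis using assms q by (simp add: padic_abs_def)
qed

lemma common_denominator:
  fixes s t :: rat
  obtains a b c where "c \<noteq> 0" "s = of_int a / of_int c" "t = of_int b / of_int c"
proof -
  obtain a1 c1 where 1: "s = Rat.Fract a1 c1" "c1 > 0" by (cases s)
  obtain a2 c2 where 2: "t = Rat.Fract a2 c2" "c2 > 0" by (cases t)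
  show thesis
    by (rule that[of "c1 * c2" "a1 * c2" "a2 * c1"]) (use 1 2 in \<open>auto simp: Fract_of_int_quotient\<close>)
qed

lemma pabs_pos: "s \<noteq> 0 \<Longrightarrow> pabs s > 0"
  using p_gt_1 by (auto simp: padic_abs_def split: prod.split)

lemma pabs_nonneg: "pabs s \<ge> 0"
  using pabs_pos[of s] by (cases "s = 0") (auto simp: pabs_zero)

lemma pabs_mult: "pabs (s * t) = pabs s * pabs t"
proof (cases "s = 0 \<or> t = 0")
  case False
  obtain a b c where c: "c \<noteq> 0" "s = of_int a / of_int c" "t = of_int b / of_int c" using common_denominator .
  then have ab: "a \<noteq> 0" "b \<noteq> 0" using False by auto
  have st: "s * t = of_int (a * b) / of_int (c * c)" using c by simp
  show ?thesis unfolding st unfolding c(2,3)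
    using ab c(1) p_gt_1 pabs_fraction[of "a * b" "c * c"]
    by (simp add: pabs_fraction v_mult power_int_add[symmetric] algebra_simps del: of_int_mult)
qed (auto simp: pabs_zero)

lemma pabs_uminus: "pabs (- s) = pabs s"
proof -
  have "pabs (-1) = 1" using pabs_fraction[of "-1" 1] by simp
  then show ?thesis using pabs_mult[of "-1" s] by simp
qed

lemma pabs_minus_commute: "pabs (s - t) = pabs (t - s)"
  using pabs_uminus[of "s - t"] by simp

lemma pabs_add_max: "pabs (s + t) \<le> max (pabs s) (pabs t)"
proof (cases "s = 0 \<or> t = 0 \<or> s + t = 0")
  case True
  then show ?thesis using pabs_nonneg[of s] by (auto simp: pabs_zero)
next
  case False
  obtain a b c where c: "c \<noteq> 0" "s = of_int a / of_int c" "t = of_int b / of_int c" using common_denominator .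
  have st: "s + t = of_int (a + b) / of_int c" using c by (simp add: add_divide_distrib)
  have ab: "a \<noteq> 0" "b \<noteq> 0" "a + b \<noteq> 0"
    using False c st by auto
  have "int p ^ min (v a) (v b) dvd a + b"
    by (intro dvd_add multiplicity_dvd') auto
  then have "min (v a) (v b) \<le> v (a + b)"
    using ab prime_int by (intro multiplicity_geI) (auto simp: not_prime_unit)
  then have "v a \<le> v (a + b) \<or> v b \<le> v (a + b)" by linarith
  then have "pabs (s + t) \<le> pabs s \<or> pabs (s + t) \<le> pabs t"
    unfolding st unfolding c(2,3) using ab c(1) p_gt_1
    by (auto simp: pabs_fraction simp del: of_int_add intro!: power_int_increasing)
  then show ?thesis by auto
qed

lemma pabs_triangle: "pabs (s + t) \<le> pabs s + pabs t"
  using pabs_add_max[of s t] pabs_nonneg[of s] pabs_nonneg[of t] by linarith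

lemma pabs_diff_triangle: "\<bar>pabs s - pabs t\<bar> \<le> pabs (s - t)"
  using pabs_triangle[of "s - t" t] pabs_triangle[of "t - s" s] pabs_minus_commute[of s t] by simp

section \<open>The ring of Cauchy sequences and its ideal of null sequences\<close>

abbreviation "CR \<equiv> padic_cauchy_ring p"
abbreviation "NI \<equiv> padic_null p"

lemma CR_simps:
  "s \<otimes>\<^bsub>CR\<^esub> t = (\<lambda>i. s i * t i)" "s \<oplus>\<^bsub>CR\<^esub> t = (\<lambda>i. s i + t i)" "\<one>\<^bsub>CR\<^esub> = (\<lambda>_. 1)" "\<zero>\<^bsub>CR\<^esub> = (\<lambda>_. 0)"
  by (simp_all add: padic_cauchy_ring_def)

lemma CR_carrier: "s \<in> carrier CR \<longleftrightarrow> (\<forall>e>0. \<exists>N. \<forall>i\<ge>N. \<forall>j\<ge>N. pabs (s i - s j) < e)"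
  by (simp add: padic_cauchy_ring_def)

lemma CR_const: "(\<lambda>_. u) \<in> carrier CR"
  by (simp add: CR_carrier pabs_zero)

lemma CR_add:
  assumes "s \<in> carrier CR" "t \<in> carrier CR"
  shows "(\<lambda>i. s i + t i) \<in> carrier CR"
  unfolding CR_carrier
proof (intro allI impI)
  fix e :: real assume e: "e > 0"
  obtain M N where M: "\<And>i j. i \<ge> M \<Longrightarrow> j \<ge> M \<Longrightarrow> pabs (s i - s j) < e"
    and N: "\<And>i j. i \<ge> N \<Longrightarrow> j \<ge> N \<Longrightarrow> pabs (t i - t j) < e"
    using assms e unfolding CR_carrier by meson
  have "pabs (s i + t i - (s j + t j)) < e" if "i \<ge> max M N" "j \<ge> max M N" for i j
    using pabs_add_max[of "s i - s j" "t i - t j"] M[of i j] N[of i j] that by (simp add: algebra_simps)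
  then show "\<exists>N. \<forall>i\<ge>N. \<forall>j\<ge>N. pabs (s i + t i - (s j + t j)) < e" by blast
qed

lemma CR_bounded:
  assumes "s \<in> carrier CR"
  obtains K N where "K > 0" "\<And>i. i \<ge> N \<Longrightarrow> pabs (s i) \<le> K"
proof -
  obtain N where N: "\<And>i j. i \<ge> N \<Longrightarrow> j \<ge> N \<Longrightarrow> pabs (s i - s j) < 1"
    using assms unfolding CR_carrier by (meson zero_less_one)
  show thesis
  proof
    show "pabs (s N) + 1 > 0" using pabs_nonneg[of "s N"] by linarith
    show "pabs (s i) \<le> pabs (s N) + 1" if "i \<ge> N" for i
      using N[of i N] that pabs_diff_triangle[of "s i" "s N"] by simp
  qed
qed

lemma CR_mult:
  assumes "s \<in> carrier CR" "t \<in> carrier CR"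
  shows "(\<lambda>i. s i * t i) \<in> carrier CR"
  unfolding CR_carrier
proof (intro allI impI)
  fix e :: real assume e: "e > 0"
  obtain K A where K: "K > 0" "\<And>i. i \<ge> A \<Longrightarrow> pabs (s i) \<le> K" using CR_bounded[OF assms(1)] by blast
  obtain L B where L: "L > 0" "\<And>i. i \<ge> B \<Longrightarrow> pabs (t i) \<le> L" using CR_bounded[OF assms(2)] by blast
  have "e / L > 0" "e / K > 0" using e K(1) L(1) by auto
  then obtain M N where M: "\<And>i j. i \<ge> M \<Longrightarrow> j \<ge> M \<Longrightarrow> pabs (s i - s j) < e / L"
    and N: "\<And>i j. i \<ge> N \<Longrightarrow> j \<ge> N \<Longrightarrow> pabs (t i - t j) < e / K"
    using assms unfolding CR_carrier by meson
  define T where "T = max (max A B) (max M N)"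
  have "pabs (s i * t i - s j * t j) < e" if "i \<ge> T" "j \<ge> T" for i j
  proof -
    have "pabs (s i * (t i - t j)) \<le> K * pabs (t i - t j)"
      using K(2)[of i] that pabs_nonneg by (auto simp: pabs_mult T_def intro!: mult_right_mono)
    also have "\<dots> < e" using N[of i j] K(1) that by (simp add: field_simps T_def)
    finally have 1: "pabs (s i * (t i - t j)) < e" .
    have "pabs ((s i - s j) * t j) \<le> pabs (s i - s j) * L"
      using L(2)[of j] that pabs_nonneg by (auto simp: pabs_mult T_def intro!: mult_left_mono)
    also have "\<dots> < e" using M[of i j] L(1) that by (simp add: field_simps T_def)
    finally have 2: "pabs ((s i - s j) * t j) < e" .
    show ?thesis using pabs_add_max[of "s i * (t i - t j)" "(s i - s j) * t j"] 1 2 by (simp add: algebra_simps)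
  qed
  then show "\<exists>N. \<forall>i\<ge>N. \<forall>j\<ge>N. pabs (s i * t i - s j * t j) < e" by blast
qed

lemma CR_uminus: "s \<in> carrier CR \<Longrightarrow> (\<lambda>i. - s i) \<in> carrier CR"
  using CR_mult[OF CR_const[of "-1"]] by simp

lemma cring_CR: "cring CR"
proof (intro cringI abelian_groupI comm_monoidI)
  fix s assume "s \<in> carrier CR"
  then show "\<exists>t\<in>carrier CR. t \<oplus>\<^bsub>CR\<^esub> s = \<zero>\<^bsub>CR\<^esub>"
    by (intro bexI[OF _ CR_uminus]) (auto simp: CR_simps)
qed (auto simp: CR_simps CR_add CR_mult CR_const algebra_simps)

lemma CR_a_inv:
  assumes "s \<in> carrier CR"
  shows "\<ominus>\<^bsub>CR\<^esub> s = (\<lambda>i. - s i)"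
proof -
  interpret cring CR by (rule cring_CR)
  show ?thesis using assms CR_uminus[OF assms] by (intro minus_equality) (auto simp: CR_simps)
qed

lemma null_iff: "s \<in> NI \<longleftrightarrow> (\<forall>e>0. \<exists>N. \<forall>i\<ge>N. pabs (s i) < e)"
  using pabs_nonneg by (simp add: padic_null_def LIMSEQ_iff)

lemma null_CR: "s \<in> NI \<Longrightarrow> s \<in> carrier CR"
  unfolding null_iff CR_carrier
proof (intro allI impI)
  fix e :: real assume "\<forall>e>0. \<exists>N. \<forall>i\<ge>N. pabs (s i) < e" "e > 0"
  then obtain N where N: "\<And>i. i \<ge> N \<Longrightarrow> pabs (s i) < e" by blast
  have "pabs (s i - s j) < e" if "i \<ge> N" "j \<ge> N" for i j
    using pabs_add_max[of "s i" "- s j"] N[of i] N[of j] that by (simp add: pabs_uminus)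
  then show "\<exists>N. \<forall>i\<ge>N. \<forall>j\<ge>N. pabs (s i - s j) < e" by blast
qed

lemma null_add:
  assumes "s \<in> NI" "t \<in> NI"
  shows "(\<lambda>i. s i + t i) \<in> NI"
  unfolding null_iff
proof (intro allI impI)
  fix e :: real assume e: "e > 0"
  obtain M N where M: "\<And>i. i \<ge> M \<Longrightarrow> pabs (s i) < e" and N: "\<And>i. i \<ge> N \<Longrightarrow> pabs (t i) < e"
    using assms e unfolding null_iff by meson
  have "pabs (s i + t i) < e" if "i \<ge> max M N" for i
    using pabs_add_max[of "s i" "t i"] M[of i] N[of i] that by simp
  then show "\<exists>N. \<forall>i\<ge>N. pabs (s i + t i) < e" by blast
qed

lemma null_mult:
  assumes "s \<in> NI" "t \<in> carrier CR"
  shows "(\<lambda>i. s i * t i) \<in> NI"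
  unfolding null_iff
proof (intro allI impI)
  fix e :: real assume e: "e > 0"
  obtain K A where K: "K > 0" "\<And>i. i \<ge> A \<Longrightarrow> pabs (t i) \<le> K" using CR_bounded[OF assms(2)] by blast
  have "e / K > 0" using e K(1) by simp
  then obtain N where N: "\<And>i. i \<ge> N \<Longrightarrow> pabs (s i) < e / K" using assms(1) unfolding null_iff by meson
  have "pabs (s i * t i) < e" if "i \<ge> max A N" for i
  proof -
    have "pabs (s i * t i) \<le> pabs (s i) * K"
      using K(2)[of i] that pabs_nonneg by (auto simp: pabs_mult intro!: mult_left_mono)
    also have "\<dots> < e" using N[of i] K(1) that by (simp add: field_simps)
    finally show ?thesis .
  qed
  then show "\<exists>N. \<forall>i\<ge>N. pabs (s i * t i) < e" by blast
qed

lemma ideal_null: "ideal NI CR"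
proof (rule idealI)
  interpret cring CR by (rule cring_CR)
  show "ring CR" by (rule ring_axioms)
  show "subgroup NI (add_monoid CR)"
  proof (rule add.subgroupI)
    have "(\<lambda>_. 0) \<in> NI" by (simp add: null_iff pabs_zero)
    then show "NI \<noteq> {}" by blast
    show "NI \<subseteq> carrier CR" using null_CR by blast
    show "\<ominus>\<^bsub>CR\<^esub> s \<in> NI" if "s \<in> NI" for s
      using null_mult[OF that CR_const[of "-1"]] that by (simp add: CR_a_inv null_CR)
    show "s \<oplus>\<^bsub>CR\<^esub> t \<in> NI" if "s \<in> NI" "t \<in> NI" for s t
      using null_add[OF that] by (simp add: CR_simps)
  qed
  show "t \<otimes>\<^bsub>CR\<^esub> s \<in> NI" "s \<otimes>\<^bsub>CR\<^esub> t \<in> NI" if "s \<in> NI" "t \<in> carrier CR" for s t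
    using null_mult[OF that] by (simp_all add: CR_simps mult.commute)
qed

section \<open>Rational numbers in the completion and their residues\<close>

lemma in_of_rat_Qp: "s \<in> of_rat_Qp p u \<Longrightarrow> (\<lambda>i. s i - u) \<in> NI"
  by (auto simp: of_rat_Qp_def a_r_coset_def r_coset_def CR_simps padic_cauchy_ring_def)

lemma const_in_of_rat_Qp: "(\<lambda>_. u) \<in> of_rat_Qp p u"
proof -
  have "(\<lambda>_. 0) \<in> NI" by (simp add: null_iff pabs_zero)
  then show ?thesis
    by (force simp: of_rat_Qp_def a_r_coset_def r_coset_def padic_cauchy_ring_def)
qed

sublocale field_hom_from_type "Qp p" "of_rat_Qp p"
proof -
  interpret ideal NI CR by (rule ideal_null)
  interpret Q: cring "Qp p"
    unfolding Qp_def by (rule quotient_is_cring[OF cring_CR])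
  note hom = ring_hom_memE[OF rcos_ring_hom, folded Qp_def]
  show "field_hom_from_type (Qp p) (of_rat_Qp p)"
  proof
    show "of_rat_Qp p u \<in> carrier (Qp p)" for u
      unfolding of_rat_Qp_def by (rule hom(1)[OF CR_const])
    show "of_rat_Qp p (u + w) = of_rat_Qp p u \<oplus>\<^bsub>Qp p\<^esub> of_rat_Qp p w" for u w
      using hom(3)[OF CR_const[of u] CR_const[of w]] by (simp add: of_rat_Qp_def CR_simps)
    show "of_rat_Qp p (u * w) = of_rat_Qp p u \<otimes>\<^bsub>Qp p\<^esub> of_rat_Qp p w" for u w
      using hom(2)[OF CR_const[of u] CR_const[of w]] by (simp add: of_rat_Qp_def CR_simps)
    show one: "of_rat_Qp p 1 = \<one>\<^bsub>Qp p\<^esub>"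
      using hom(4) by (simp add: of_rat_Qp_def CR_simps)
    show "\<one>\<^bsub>Qp p\<^esub> \<noteq> \<zero>\<^bsub>Qp p\<^esub>"
    proof
      assume "\<one>\<^bsub>Qp p\<^esub> = \<zero>\<^bsub>Qp p\<^esub>"
      then have "of_rat_Qp p 1 = NI" using one by (simp add: Qp_def FactRing_def)
      then have "(\<lambda>_. 1) \<in> NI" using const_in_of_rat_Qp[of 1] by simp
      then show False using pabs_pos[of 1] by (auto simp: null_iff)
    qed
  qed
qed

text \<open>Whichever representative \<open>SOME\<close> picks, it differs from the constant u by a
  null sequence, so its absolute values converge to that of u.\<close>

lemma Qp_abs_of_rat: "Qp_abs p (of_rat_Qp p u) = pabs u"
proof -
  define s where "s = (SOME s. s \<in> of_rat_Qp p u)"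
  have "s \<in> of_rat_Qp p u" unfolding s_def using const_in_of_rat_Qp[of u] by (rule someI[where P = "\<lambda>s. s \<in> of_rat_Qp p u"])
  then have null: "(\<lambda>i. pabs (s i - u)) \<longlonglongrightarrow> 0" using in_of_rat_Qp by (simp add: padic_null_def)
  have "(\<lambda>i. pabs (s i) - pabs u) \<longlonglongrightarrow> 0"
    by (rule tendsto_rabs_zero_cancel, rule tendsto_sandwich[OF _ _ tendsto_const null])
      (auto simp: pabs_diff_triangle)
  then have "(\<lambda>i. pabs (s i)) \<longlonglongrightarrow> pabs u" by (simp add: LIM_zero_iff)
  then show ?thesis unfolding Qp_abs_def s_def[symmetric] by (rule limI)
qed

lemma pabs_integral:
  assumes "\<not> int p dvd b"
  shows "pabs (of_int a / of_int b) \<le> 1" "pabs (of_int a / of_int b) < 1 \<longleftrightarrow> int p dvd a"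
proof -
  have b: "b \<noteq> 0" "v b = 0" using assms by (auto simp: not_dvd_imp_multiplicity_0)
  have "pabs (of_int a / of_int b) \<le> 1 \<and> (pabs (of_int a / of_int b) < 1 \<longleftrightarrow> int p dvd a)"
  proof (cases "a = 0")
    case False
    then have eq: "pabs (of_int a / of_int b) = real p powi (- int (v a))" using pabs_fraction b by simp
    show ?thesis
    proof (cases "int p dvd a")
      case True
      then have "v a > 0" using False prime_int by (simp add: prime_multiplicity_gt_zero_iff)
      then have "real p powi (- int (v a)) < real p powi 0"
        using p_gt_1 by (intro power_int_strict_increasing) auto
      then show ?thesis using eq True by simp
    next
      case no: False
      then show ?thesis using eq by (simp add: not_dvd_imp_multiplicity_0)
    qed
  qed (simp add: pabs_zero)
  then show "pabs (of_int a / of_int b) \<le> 1" "pabs (of_int a / of_int b) < 1 \<longleftrightarrow> int p dvd a" by auto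
qed

lemma of_rat_in_Zp: "\<not> int p dvd b \<Longrightarrow> of_rat_Qp p (of_int a / of_int b) \<in> Zp p"
  using f_closed pabs_integral(1) by (simp add: Zp_def Qp_abs_of_rat)

text \<open>Resolves the description in \<open>residue_Zp\<close>: the only candidate is a z mod p,
  where z inverts b modulo p.\<close>

lemma residue_of_rat:
  fixes a b :: int
  assumes b: "\<not> int p dvd b"
  defines "c \<equiv> residue_Zp p (of_rat_Qp p (of_int a / of_int b))"
  shows "0 \<le> c" "c < int p" "[a = c * b] (mod int p)"
proof -
  let ?P = "\<lambda>c. c \<in> carrier (residue_ring (int p)) \<and>
     Qp_abs p (of_rat_Qp p (of_int a / of_int b) \<ominus>\<^bsub>Qp p\<^esub> of_rat_Qp p (of_int c)) < 1"
  have P_iff: "?P c \<longleftrightarrow> 0 \<le> c \<and> c < int p \<and> [a = c * b] (mod int p)" for c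
  proof -
    have "of_int a / of_int b - of_int c = (of_int (a - c * b) / of_int b :: rat)"
    proof -
      have "b \<noteq> 0" using b by auto
      then show ?thesis by (simp add: field_simps)
    qed
    then show ?thesis
      unfolding f_diff[symmetric] Qp_abs_of_rat using pabs_integral(2)[OF b, of "a - c * b"]
      by (auto simp: residue_ring_def cong_iff_dvd_diff)
  qed
  have "coprime b (int p)" using b prime_imp_coprime[OF prime_int, of b] coprime_commute by blast
  then obtain z where z: "[b * z = 1] (mod int p)" using cong_solve_coprime_int by blast
  have pos: "int p > 0" using prime_gt_0_nat[OF prime_p] by simp
  have "[a = (a * z mod int p) * b] (mod int p)"
  proof -
    have "[a * (b * z) = a * 1] (mod int p)" using cong_scalar_left[OF z] .
    then show ?thesis by (simp add: cong_def mod_simps ac_simps)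
  qed
  then have ex: "?P (a * z mod int p)" unfolding P_iff using pos by simp
  have "\<exists>!c. ?P c"
  proof (rule ex1I[where P = ?P and a = "a * z mod int p", OF ex])
    fix c assume "?P c"
    then have c: "0 \<le> c" "c < int p" "[a = c * b] (mod int p)" unfolding P_iff by auto
    have "[c * b * z = a * z] (mod int p)" using cong_scalar_right[OF c(3), of z] by (simp add: cong_sym)
    moreover have "[c * b * z = c] (mod int p)" using cong_scalar_left[OF z, of c] by (simp add: mult.assoc)
    ultimately have "[c = a * z] (mod int p)" by (meson cong_sym cong_trans)
    then show "c = a * z mod int p" using c by (simp add: cong_def)
  qed
  then have "?P c" unfolding c_def residue_Zp_def by (rule theI')
  then show "0 \<le> c" "c < int p" "[a = c * b] (mod int p)" unfolding P_iff by auto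
qed

end

subsection \<open>The order modulo \<open>E\<^sub>0\<close> and the sequence \<open>\<beta>\<close>\<close>

lemma residue_ring_hom:
  assumes "Factorial_Ring.prime p"
  shows "ring_hom_from_type (residue_ring (int p)) (\<lambda>k. k mod int p)"
proof -
  have p: "1 < int p" using prime_gt_1_nat[OF assms] by simp
  interpret residues "int p" "residue_ring (int p)" by (rule residues.intro[OF p])
  show ?thesis
    by unfold_locales (use p in \<open>auto simp: residue_ring_def mod_simps\<close>)
qed

text \<open>On the reduced curve \<open>form1\<close> is the square of \<open>wdy\<close>, and
  \<open>form2\<close> is the square of \<open>wdx\<close> up to a multiple of \<open>wdy\<close>.
  At a common zero both partial derivatives vanish.\<close>

lemma residue_nonsingular_imp:
  assumes p: "Factorial_Ring.prime p" and ab: "0 \<le> a" "a < int p" "0 \<le> b" "b < int p"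
    and ns: "nonsingular_point (residue_ring (int p)) E (Affine a b)"
  shows "\<not> (int p dvd form1 E a 1 a 1 \<and> int p dvd form2 E a 1 a 1)"
proof
  interpret r: ring_hom_from_type "residue_ring (int p)" "\<lambda>k. k mod int p"
    by (rule residue_ring_hom[OF p])
  assume f: "int p dvd form1 E a 1 a 1 \<and> int p dvd form2 E a 1 a 1"
  have pi: "Factorial_Ring.prime (int p)" using p by simp
  have mod: "a mod int p = a" "b mod int p = b" using ab by auto
  define c where "c = b\<^sup>2 + a\<^sub>1 E * a * b + a\<^sub>3 E * b - (a ^ 3 + a\<^sub>2 E * a\<^sup>2 + a\<^sub>4 E * a + a\<^sub>6 E)"
  have c: "int p dvd c"
    using ns r.on_curve_hom[of E a b] unfolding mod c_def
    by (simp add: mod_eq_dvd_iff)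
  have 1: "(wdy E a b)\<^sup>2 = form1 E a 1 a 1 + 4 * c"
    unfolding form_at_one c_def wdy_def of_int_eq_id id_apply b\<^sub>2_def b\<^sub>4_def b\<^sub>6_def by Groebner_Basis.algebra
  have 2: "(wdx E a b)\<^sup>2 = form2 E a 1 a 1 + wdy E a b * (a\<^sub>1 E * wdx E a b + (a\<^sub>2 E + 2 * a) * wdy E a b) - c * (b\<^sub>2 E + 8 * a)"
    unfolding form_at_one c_def wdy_def wdx_def of_int_eq_id id_apply b\<^sub>2_def b\<^sub>4_def b\<^sub>6_def b\<^sub>8_def by Groebner_Basis.algebra
  have "int p dvd (wdy E a b)\<^sup>2" unfolding 1 using f c by simp
  then have dy: "int p dvd wdy E a b" using pi prime_dvd_power by blast
  have "int p dvd (wdx E a b)\<^sup>2" unfolding 2 using f c dy by simp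
  then have "int p dvd wdx E a b" using pi prime_dvd_power by blast
  then show False
    using ns dy r.curve_dx_hom[of E a b] r.curve_dy_hom[of E a b] r.f_zero unfolding mod by auto
qed

context rational_point
begin

text \<open>Singularity makes the denominator prime to p, so \<open>reduce_point\<close> takes its
  affine branch. By homogeneity the forms also vanish at the residue of x_r, contradicting
  \<open>residue_nonsingular_imp\<close>.\<close>

lemma not_singular_at_if_E0:
  assumes p: "Factorial_Ring.prime p" and r: "r \<ge> 1"
    and E0: "map_point (of_rat_Qp p) P [^]\<^bsub>EQp E p\<^esub> r \<in> E0 E p"
  shows "\<not> singular_at (int p) r"
proof
  interpret padic p by unfold_locales (rule p)
  assume sing: "singular_at (int p) r"
  have pt: "map_point (of_rat_Qp p) P [^]\<^bsub>EQp E p\<^esub> r = Affine (of_rat_Qp p (x r)) (of_rat_Qp p (y r))"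
    unfolding curve_group_pow_hom[OF P] wmult_eq[OF r] by simp
  have "\<not> int p dvd (den r)\<^sup>2"
    using not_dvd_D_if_singular_mod[OF prime_int coprime_num[OF r]] sing unfolding singular_at_def by blast
  then have den: "\<not> int p dvd (den r)\<^sup>2" "\<not> int p dvd den r ^ 3" "\<not> int p dvd den r"
    using prime_int prime_dvd_power[of "int p" "den r" 3] by (auto simp: power2_eq_square)
  obtain C where y: "y r = of_int C / of_int (den r ^ 3)" using den_num(4)[OF r] by auto
  have x: "x r = of_int (num r) / of_int ((den r)\<^sup>2)" using den_num(3)[OF r] by simp
  define a b where "a = residue_Zp p (of_rat_Qp p (x r))" and "b = residue_Zp p (of_rat_Qp p (y r))"
  have "reduce_point p (Affine (of_rat_Qp p (x r)) (of_rat_Qp p (y r))) = Affine a b"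
    using of_rat_in_Zp[OF den(1), of "num r"] of_rat_in_Zp[OF den(2), of C]
    unfolding x[symmetric] y[symmetric] by (simp add: a_def b_def)
  then have ns: "nonsingular_point (residue_ring (int p)) E (Affine a b)"
    using E0 unfolding pt E0_def by simp
  have a: "0 \<le> a" "a < int p" "[num r = a * (den r)\<^sup>2] (mod int p)"
    using residue_of_rat[OF den(1), of "num r"] unfolding x[symmetric] a_def by auto
  have b: "0 \<le> b" "b < int p"
    using residue_of_rat[OF den(2), of C] unfolding y[symmetric] b_def by auto
  have "\<not> int p dvd ((den r)\<^sup>2) ^ 4" using den(1) prime_int prime_dvd_power by blast
  then have "int p dvd form1 E a 1 a 1 \<and> int p dvd form2 E a 1 a 1"
    using sing singular_mod_scale[OF a(3), of E] prime_int unfolding singular_at_def singular_mod_def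
    by (metis cong_dvd_iff prime_dvd_mult_iff)
  then show False using residue_nonsingular_imp[OF p a(1,2) b ns] by blast
qed

lemma not_singular_at_if_M_dvd:
  assumes "M_of E P dvd k" "k \<ge> 1" "Factorial_Ring.prime (p :: int)"
  shows "\<not> singular_at p k"
proof -
  obtain q where q: "p = int q" using prime_ge_0_int[OF assms(3)] by (metis nonneg_int_cases)
  have pq: "Factorial_Ring.prime q" using assms(3) q by simp
  define r where "r = order_mod_E0 E P q"
  have "r dvd M_of E P" unfolding M_of_def r_def using pq by (intro dvd_Lcm) auto
  then have "r dvd k" using assms(1) dvd_trans by blast
  then obtain j where j: "k = j * r" by (metis dvdE mult.commute)
  \<comment> \<open>\<open>order_mod_E0\<close> is 0 when no positive multiple lies in
    \<open>E0\<close>; k \<ge> 1 rules this value out for a divisor of k.\<close>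
  then have r1: "r \<ge> 1" "j \<ge> 1" using assms(2) by (auto simp: Suc_le_eq)
  define triv where "triv = (\<lambda>k::nat. k > 0 \<and> map_point (of_rat_Qp q) P [^]\<^bsub>EQp E q\<^esub> k \<in> E0 E q)"
  have "r = (if \<exists>k. triv k then (LEAST k. triv k) else 0)"
    unfolding r_def order_mod_E0_def triv_def Let_def ..
  then have "triv r" using r1(1) LeastI_ex[of triv] by (auto split: if_splits)
  then have "\<not> singular_at p r" using not_singular_at_if_E0[OF pq r1(1)] q by (auto simp: triv_def)
  then show ?thesis using not_singular_at_multiple[OF assms(3) _ r1] j by simp
qed

end

section \<open>The group of rational points in type-class form\<close>

lemma type_algebra_hom: "field_hom_from_type ring_of_type_algebra (\<lambda>u::'a::field. u)"
proof -
  interpret cring "ring_of_type_algebra :: 'a ring" by rule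
  show ?thesis by unfold_locales (auto simp: ring_of_type_algebra_def)
qed

lemma EQ_pow: "wpoint E P \<Longrightarrow> P [^]\<^bsub>EQ E\<^esub> n = wmult E P n"
  using field_hom_from_type.curve_group_pow_hom[OF type_algebra_hom, of E P n]
  by (simp add: point.map_ident)

lemma wpoint_iff_EQ: "P \<in> carrier (EQ E) \<longleftrightarrow> wpoint E P"
proof -
  interpret field_hom_from_type ring_of_type_algebra "\<lambda>u::rat. u" by (rule type_algebra_hom)
  show ?thesis
    using f_closed on_curve_hom by (cases P) (auto simp: curve_group_def weq_def)
qed

section \<open>Products of terms of the sequence \<beta>\<close>

context rational_point
begin

lemma psi_at_P: "psi_at E n P = W n"
  using psi_eq_W[of n] arg_cong[OF P_eq, of "psi_at E n"] by simp

lemma beta_eq: "beta E P n = sgn (W n) * of_int (den n) / of_int (den 1)"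
  unfolding beta_def B_seq_def den_def EQ_pow[OF P] psi_at_P ..

lemma beta_zero: "beta E P 0 = 0"
  by (simp add: beta_eq)

lemma sgn_W_square: "n \<ge> 1 \<Longrightarrow> (sgn (W n))\<^sup>2 = 1"
  using W_nonzero[of n] by (simp add: sgn_if)

lemma beta_square:
  assumes "n \<ge> 1"
  shows "(beta E P n)\<^sup>2 = (of_int (den n))\<^sup>2 / (of_int (den 1))\<^sup>2"
  unfolding beta_eq power_divide power_mult_distrib sgn_W_square[OF assms] by simp

lemma beta_mult_beta:
  assumes mn: "m \<ge> 1" "m < n" and M: "M_of E P dvd n \<or> M_of E P dvd m"
  shows "beta E P (n + m) * beta E P (n - m) =
    (of_int (den 1))\<^sup>2 * (x m - x n) * (beta E P n)\<^sup>2 * (beta E P m)\<^sup>2"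
proof -
  have ge: "n \<ge> 1" "n + m \<ge> 1" "n - m \<ge> 1" using mn by auto
  \<comment> \<open>Whichever of n and m is a multiple of M(P) is non-singular at every
    prime.\<close>
  have den: "of_int (den (n + m) * den (n - m)) = \<bar>x m - x n\<bar> * (of_int (den n))\<^sup>2 * (of_int (den m))\<^sup>2"
    using not_singular_at_if_M_dvd M ge mn by (intro den_mult_den) blast+
  have "sgn (W (n + m)) * sgn (W (n - m)) = sgn (W (n + m) * W (n - m))" by (simp add: sgn_mult)
  also have "\<dots> = sgn (x m - x n)"
    unfolding ward_identity[OF mn(1) less_imp_le[OF mn(2)]]
    using sgn_W_square[OF ge(1)] sgn_W_square[OF mn(1)] by (simp add: sgn_mult power2_eq_square)
  finally have sgn: "sgn (W (n + m)) * sgn (W (n - m)) = sgn (x m - x n)" .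
  have "beta E P (n + m) * beta E P (n - m) =
     (sgn (W (n + m)) * sgn (W (n - m))) * of_int (den (n + m) * den (n - m)) / (of_int (den 1))\<^sup>2"
    unfolding beta_eq by (simp add: power2_eq_square)
  also have "\<dots> = (sgn (x m - x n) * \<bar>x m - x n\<bar>) * (of_int (den n))\<^sup>2 * (of_int (den m))\<^sup>2 / (of_int (den 1))\<^sup>2"
    unfolding sgn den by simp
  also have "sgn (x m - x n) * \<bar>x m - x n\<bar> = x m - x n" by (simp add: sgn_mult_abs)
  finally show ?thesis
    unfolding beta_square[OF ge(1)] beta_square[OF mn(1)] using den_num(1)[of 1] by simp
qed

end

theorem theorem1p11:
  fixes E :: weierstrass and P :: "rat point" and n m r :: nat
  assumes "elliptic_curve E"
    and "P \<in> carrier (EQ E)"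
    and "non_torsion E P"
    and "n \<ge> m" and "m \<ge> r" and "r > 0"
    and "(M_of E P dvd n \<and> M_of E P dvd m) \<or> (M_of E P dvd n \<and> M_of E P dvd r) \<or> (M_of E P dvd m \<and> M_of E P dvd r)"
  shows "beta E P (n + m) * beta E P (n - m) * (beta E P r)\<^sup>2 =
         beta E P (n + r) * beta E P (n - r) * (beta E P m)\<^sup>2
         - beta E P (m + r) * beta E P (m - r) * (beta E P n)\<^sup>2"
proof -
  interpret rational_point E P
  proof
    show P: "wpoint E P" using assms(2) by (simp add: wpoint_iff_EQ)
    show "wmult E P k \<noteq> Infinity" if "k \<ge> 1" for k
    proof -
      have "P [^]\<^bsub>EQ E\<^esub> k \<noteq> \<one>\<^bsub>EQ E\<^esub>" using assms(3) that by (simp add: non_torsion_def)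
      then show ?thesis unfolding EQ_pow[OF P] by (simp add: curve_group_def)
    qed
  qed
  show ?thesis
  \<comment> \<open>With equal indices one product contains \<beta>_0 = 0 and the other two
    coincide.\<close>
  proof (cases "n = m \<or> m = r")
    case True
    then show ?thesis using beta_zero by auto
  next
    case False
    then have lt: "n > m" "m > r" "r \<ge> 1" "m \<ge> 1" "n > r" using assms by auto
    \<comment> \<open>Two of n, m, r are multiples of M(P), so each of the three pairs contains
      one.\<close>
    have "beta E P (n + m) * beta E P (n - m) = (of_int (den 1))\<^sup>2 * (x m - x n) * (beta E P n)\<^sup>2 * (beta E P m)\<^sup>2"
      "beta E P (n + r) * beta E P (n - r) = (of_int (den 1))\<^sup>2 * (x r - x n) * (beta E P n)\<^sup>2 * (beta E P r)\<^sup>2"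
      "beta E P (m + r) * beta E P (m - r) = (of_int (den 1))\<^sup>2 * (x r - x m) * (beta E P m)\<^sup>2 * (beta E P r)\<^sup>2"
      using assms(7) lt by (intro beta_mult_beta; blast)+
    then show ?thesis by Groebner_Basis.algebra
  qed
qed

end
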